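(* Let $R$ be an associative ring with identity. Every left $R$-module has a surjective phantom cover. That is, for every left $R$-module $N$ there is a surjective homomorphism $\phi:M\to N$ which is a phantom cover of $N$.
   Context: Modules are unitary left $R$-modules. A morphism $f:M\to N$ of left $R$-modules is a phantom morphism if for each morphism $g:L\to M$ with $L$ a finitely presented left $R$-module, the composition $f\circ g$ factors through a (finitely presented) projective module. A phantom cover of $N$ is a phantom morphism $\phi:M\to N$ such that (1) every phantom morphism $\phi':M'\to N$ factors through $\phi$, i.e. there is $k:M'\to M$ with $\phi\circ k=\phi'$; and (2) every endomorphism $j:M\to M$ with $\phi\circ j=\phi$ is an automorphism. *)

theory Defs
  imports "HOL-Algebra.Module" "HOL-Library.FuncSet"
begin

text \<open>
  The locale \<open>module\<close> of HOL-Algebra requires a commutative ring of scalars.  Below, its record type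
  is reused for left modules over an arbitrary (associative, unital) ring; the fields \<open>mult\<close> and
  \<open>one\<close> of the module record carry no meaning.  Functions are only significant on carriers, so
  morphisms are always compared pointwise on the carrier of their domain.
\<close>

locale left_module = R?: ring R + M?: abelian_group M
  for R :: "('r, 'z) ring_scheme" (structure) and M :: "('r, 'm, 'y) module_scheme" (structure) +
  assumes smult_closed [simp, intro]:
      "\<lbrakk>a \<in> carrier R; x \<in> carrier M\<rbrakk> \<Longrightarrow> a \<odot>\<^bsub>M\<^esub> x \<in> carrier M"
    and smult_l_distr:
      "\<lbrakk>a \<in> carrier R; b \<in> carrier R; x \<in> carrier M\<rbrakk> \<Longrightarrow>
       (a \<oplus>\<^bsub>R\<^esub> b) \<odot>\<^bsub>M\<^esub> x = a \<odot>\<^bsub>M\<^esub> x \<oplus>\<^bsub>M\<^esub> b \<odot>\<^bsub>M\<^esub> x"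
    and smult_r_distr:
      "\<lbrakk>a \<in> carrier R; x \<in> carrier M; y \<in> carrier M\<rbrakk> \<Longrightarrow>
       a \<odot>\<^bsub>M\<^esub> (x \<oplus>\<^bsub>M\<^esub> y) = a \<odot>\<^bsub>M\<^esub> x \<oplus>\<^bsub>M\<^esub> a \<odot>\<^bsub>M\<^esub> y"
    and smult_assoc1:
      "\<lbrakk>a \<in> carrier R; b \<in> carrier R; x \<in> carrier M\<rbrakk> \<Longrightarrow>
       (a \<otimes>\<^bsub>R\<^esub> b) \<odot>\<^bsub>M\<^esub> x = a \<odot>\<^bsub>M\<^esub> (b \<odot>\<^bsub>M\<^esub> x)"
    and smult_one [simp]:
      "x \<in> carrier M \<Longrightarrow> \<one>\<^bsub>R\<^esub> \<odot>\<^bsub>M\<^esub> x = x"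

definition mod_hom ::
    "('r, 'z) ring_scheme \<Rightarrow> ('r, 'm, 'x) module_scheme \<Rightarrow> ('r, 'n, 'y) module_scheme \<Rightarrow> ('m \<Rightarrow> 'n) set"
  where "mod_hom R M N =
    {h \<in> carrier M \<rightarrow> carrier N.
       (\<forall>x\<in>carrier M. \<forall>y\<in>carrier M. h (x \<oplus>\<^bsub>M\<^esub> y) = h x \<oplus>\<^bsub>N\<^esub> h y) \<and>
       (\<forall>a\<in>carrier R. \<forall>x\<in>carrier M. h (a \<odot>\<^bsub>M\<^esub> x) = a \<odot>\<^bsub>N\<^esub> h x)}"

definition mod_span :: "('r, 'z) ring_scheme \<Rightarrow> ('r, 'm, 'y) module_scheme \<Rightarrow> 'm set \<Rightarrow> 'm set"
  where "mod_span R M S = \<Inter>{K. submodule K R M \<and> S \<subseteq> K}"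

definition free_mod :: "('r, 'z) ring_scheme \<Rightarrow> nat \<Rightarrow> ('r, nat \<Rightarrow> 'r) module"
  where "free_mod R n =
    \<lparr>carrier = {..<n} \<rightarrow>\<^sub>E carrier R, mult = undefined, one = undefined,
     zero = (\<lambda>i\<in>{..<n}. \<zero>\<^bsub>R\<^esub>),
     add = (\<lambda>x y. \<lambda>i\<in>{..<n}. x i \<oplus>\<^bsub>R\<^esub> y i),
     smult = (\<lambda>a x. \<lambda>i\<in>{..<n}. a \<otimes>\<^bsub>R\<^esub> x i)\<rparr>"

definition fin_presented :: "('r, 'z) ring_scheme \<Rightarrow> ('r, 'm, 'y) module_scheme \<Rightarrow> bool"
  where "fin_presented R L \<longleftrightarrow> left_module R L \<and>
    (\<exists>n p S. p \<in> mod_hom R (free_mod R n) L \<and> p ` carrier (free_mod R n) = carrier L \<and>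
       finite S \<and> S \<subseteq> carrier (free_mod R n) \<and>
       {x \<in> carrier (free_mod R n). p x = \<zero>\<^bsub>L\<^esub>} = mod_span R (free_mod R n) S)"

text \<open>
  HOL formulas cannot quantify over types.  A finitely presented module is a quotient of some
  \<open>R\<^sup>n\<close>, hence isomorphic to a module whose elements are subsets of \<open>R\<^sup>n\<close>.  So the following type
  accommodates every finitely presented \<open>R\<close>-module up to isomorphism, and quantification over
  modules of this type amounts to quantification over all of them; see \<open>fin_presented_copy\<close>,
  \<open>fp_projective_lift\<close> and \<open>phantom_factors\<close> below.
\<close>

type_synonym 'r fp_carrier = "(nat \<Rightarrow> 'r) set"

text \<open>
  For a finitely presented module, it is enough to state the lifting property against epimorphisms
  between modules carried by this type, since one of these is (a copy of) \<open>R\<^sup>n \<rightarrow> P\<close>.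
\<close>

definition fp_projective :: "('r, 'z) ring_scheme \<Rightarrow> ('r, 'p, 'y) module_scheme \<Rightarrow> bool"
  where "fp_projective R P \<longleftrightarrow> fin_presented R P \<and>
    (\<forall>(A :: ('r, 'r fp_carrier) module) (B :: ('r, 'r fp_carrier) module) e f.
       left_module R A \<and> left_module R B \<and>
       e \<in> mod_hom R A B \<and> e ` carrier A = carrier B \<and> f \<in> mod_hom R P B \<longrightarrow>
       (\<exists>h \<in> mod_hom R P A. \<forall>x\<in>carrier P. e (h x) = f x))"

definition phantom ::
    "('r, 'z) ring_scheme \<Rightarrow> ('r, 'm, 'x) module_scheme \<Rightarrow> ('r, 'n, 'y) module_scheme \<Rightarrow> ('m \<Rightarrow> 'n) \<Rightarrow> bool"
  where "phantom R M N f \<longleftrightarrow>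
    left_module R M \<and> left_module R N \<and> f \<in> mod_hom R M N \<and>
    (\<forall>(L :: ('r, 'r fp_carrier) module) g.
       fin_presented R L \<and> g \<in> mod_hom R L M \<longrightarrow>
       (\<exists>(P :: ('r, 'r fp_carrier) module) u v.
          fp_projective R P \<and> u \<in> mod_hom R L P \<and> v \<in> mod_hom R P N \<and>
          (\<forall>x\<in>carrier L. f (g x) = v (u x))))"

definition mod_automorphism ::
    "('r, 'z) ring_scheme \<Rightarrow> ('r, 'm, 'y) module_scheme \<Rightarrow> ('m \<Rightarrow> 'm) \<Rightarrow> bool"
  where "mod_automorphism R M j \<longleftrightarrow> j \<in> mod_hom R M M \<and> bij_betw j (carrier M) (carrier M)"

text \<open>
  The first argument records the type over which the domains \<open>M'\<close> of the competing phantom morphisms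
  range.  Being a phantom cover of \<open>N\<close> means that \<open>phantom_cover TYPE('t) R M N \<phi>\<close> holds for every
  type \<open>'t\<close>.
\<close>

definition phantom_cover ::
    "'t itself \<Rightarrow> ('r, 'z) ring_scheme \<Rightarrow> ('r, 'm, 'x) module_scheme \<Rightarrow> ('r, 'n, 'y) module_scheme \<Rightarrow>
     ('m \<Rightarrow> 'n) \<Rightarrow> bool"
  where "phantom_cover T R M N \<phi> \<longleftrightarrow>
    phantom R M N \<phi> \<and>
    (\<forall>(M' :: ('r, 't) module) \<phi>'. phantom R M' N \<phi>' \<longrightarrow>
       (\<exists>k \<in> mod_hom R M' M. \<forall>x\<in>carrier M'. \<phi> (k x) = \<phi>' x)) \<and>
    (\<forall>j \<in> mod_hom R M M. (\<forall>x\<in>carrier M. \<phi> (j x) = \<phi> x) \<longrightarrow> mod_automorphism R M j)"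

text \<open>
  A type depending only on the types of ring and module, large enough to carry the domain of the
  phantom cover: if \<open>0 \<rightarrow> K \<rightarrow> F \<rightarrow> N \<rightarrow> 0\<close> is exact with \<open>F\<close> free on \<open>N\<close>, pushing out along the
  pure embedding of \<open>K\<close> into its double character module yields a phantom morphism onto \<open>N\<close>
  through which all others factor, and its domain has at most \<open>2 ^ (2 ^ (|R| + |N| + \<aleph>\<^sub>0))\<close> elements.
  The domain of the cover is a direct summand of it.
  Since type variables are quantified outermost, "there is one cover good for all types \<open>'t\<close>" is to be
  stated in two parts: a cover with respect to this type exists, and every such cover is a cover
  with respect to an arbitrary type \<open>'t\<close>.
\<close>

type_synonym ('r, 'n) cover_carrier = "('r + 'n + nat) list set set"


subsection \<open>Independence of the chosen type of finitely presented modules\<close>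

lemma mod_homI:
  assumes "\<And>x. x \<in> carrier M \<Longrightarrow> h x \<in> carrier N"
    and "\<And>x y. x \<in> carrier M \<Longrightarrow> y \<in> carrier M \<Longrightarrow> h (x \<oplus>\<^bsub>M\<^esub> y) = h x \<oplus>\<^bsub>N\<^esub> h y"
    and "\<And>a x. a \<in> carrier R \<Longrightarrow> x \<in> carrier M \<Longrightarrow> h (a \<odot>\<^bsub>M\<^esub> x) = a \<odot>\<^bsub>N\<^esub> h x"
  shows "h \<in> mod_hom R M N"
  using assms unfolding mod_hom_def by auto

lemma mod_homD:
  assumes "h \<in> mod_hom R M N"
  shows "x \<in> carrier M \<Longrightarrow> h x \<in> carrier N"
    and "x \<in> carrier M \<Longrightarrow> y \<in> carrier M \<Longrightarrow> h (x \<oplus>\<^bsub>M\<^esub> y) = h x \<oplus>\<^bsub>N\<^esub> h y"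
    and "a \<in> carrier R \<Longrightarrow> x \<in> carrier M \<Longrightarrow> h (a \<odot>\<^bsub>M\<^esub> x) = a \<odot>\<^bsub>N\<^esub> h x"
  using assms unfolding mod_hom_def by auto

lemma mod_hom_comp:
  assumes "g \<in> mod_hom R L M" "f \<in> mod_hom R M N"
  shows "(\<lambda>x. f (g x)) \<in> mod_hom R L N"
  using assms unfolding mod_hom_def by (auto simp: Pi_iff)

lemma mod_hom_zero:
  assumes "left_module R M" "left_module R N" "h \<in> mod_hom R M N"
  shows "h \<zero>\<^bsub>M\<^esub> = \<zero>\<^bsub>N\<^esub>"
proof -
  interpret M: left_module R M by fact
  interpret N: left_module R N by fact
  have "h \<zero>\<^bsub>M\<^esub> \<oplus>\<^bsub>N\<^esub> h \<zero>\<^bsub>M\<^esub> = h \<zero>\<^bsub>M\<^esub>"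
    using mod_homD(2)[OF assms(3), of "\<zero>\<^bsub>M\<^esub>" "\<zero>\<^bsub>M\<^esub>"] by simp
  with mod_homD(1)[OF assms(3), of "\<zero>\<^bsub>M\<^esub>"] show ?thesis
    by (metis N.M.add.l_cancel_one' N.M.zero_closed M.M.zero_closed)
qed

lemma left_module_free_mod:
  assumes "ring R" shows "left_module R (free_mod R n)"
proof -
  interpret R: ring R by fact
  have "abelian_group (free_mod R n)"
  proof (rule abelian_groupI)
    fix x assume x: "x \<in> carrier (free_mod R n)"
    show "\<exists>y\<in>carrier (free_mod R n). y \<oplus>\<^bsub>free_mod R n\<^esub> x = \<zero>\<^bsub>free_mod R n\<^esub>"
    proof (rule bexI)
      show "(\<lambda>i\<in>{..<n}. \<ominus>\<^bsub>R\<^esub> x i) \<in> carrier (free_mod R n)"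
        using x by (auto simp: free_mod_def)
      show "(\<lambda>i\<in>{..<n}. \<ominus>\<^bsub>R\<^esub> x i) \<oplus>\<^bsub>free_mod R n\<^esub> x = \<zero>\<^bsub>free_mod R n\<^esub>"
        using x by (auto simp: free_mod_def fun_eq_iff PiE_iff R.l_neg restrict_def)
    qed
  qed (auto simp: free_mod_def fun_eq_iff PiE_iff restrict_def R.a_ac extensional_def)
  then show ?thesis
    by (intro left_module.intro left_module_axioms.intro assms)
       (auto simp: free_mod_def fun_eq_iff PiE_iff restrict_def R.l_distr R.r_distr R.m_assoc extensional_def)
qed

lemma left_module_copy:
  fixes M :: "('r, 'm, 'y) module_scheme" and \<tau> :: "'m \<Rightarrow> 'c"
  assumes "left_module R M" and "inj_on \<tau> (carrier M)"
  obtains M' :: "('r, 'c) module" and \<sigma>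
  where "left_module R M'" "carrier M' = \<tau> ` carrier M"
    "\<tau> \<in> mod_hom R M M'" "\<sigma> \<in> mod_hom R M' M"
    "\<And>x. x \<in> carrier M \<Longrightarrow> \<sigma> (\<tau> x) = x" "\<And>y. y \<in> carrier M' \<Longrightarrow> \<tau> (\<sigma> y) = y"
proof -
  interpret M: left_module R M by fact
  define \<sigma> where "\<sigma> = inv_into (carrier M) \<tau>"
  define M' :: "('r, 'c) module" where "M' =
    \<lparr>carrier = \<tau> ` carrier M, mult = undefined, one = undefined, zero = \<tau> \<zero>\<^bsub>M\<^esub>,
     add = (\<lambda>x y. \<tau> (\<sigma> x \<oplus>\<^bsub>M\<^esub> \<sigma> y)), smult = (\<lambda>a x. \<tau> (a \<odot>\<^bsub>M\<^esub> \<sigma> x))\<rparr>"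
  have st: "\<sigma> (\<tau> x) = x" if "x \<in> carrier M" for x
    using that assms(2) by (simp add: \<sigma>_def)
  have "abelian_group M'"
  proof (rule abelian_groupI)
    fix x assume x: "x \<in> carrier M'"
    then obtain x0 where x0: "x0 \<in> carrier M" "x = \<tau> x0" by (auto simp: M'_def)
    then show "\<exists>y\<in>carrier M'. y \<oplus>\<^bsub>M'\<^esub> x = \<zero>\<^bsub>M'\<^esub>"
      by (intro bexI[of _ "\<tau> (\<ominus>\<^bsub>M\<^esub> x0)"]) (auto simp: M'_def st M.M.l_neg)
  qed (auto simp: M'_def st M.M.a_ac)
  then have lm: "left_module R M'"
    by (intro left_module.intro left_module_axioms.intro M.R.ring_axioms)
       (auto simp: M'_def st M.smult_l_distr M.smult_r_distr M.smult_assoc1)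
  show thesis
    by (rule that[OF lm, of \<sigma>]) (auto simp: M'_def st intro!: mod_homI)
qed

lemma fin_presented_iso:
  assumes "fin_presented R L" "left_module R L'" "\<tau> \<in> mod_hom R L L'"
    and "bij_betw \<tau> (carrier L) (carrier L')"
  shows "fin_presented R L'"
proof -
  obtain n p S where p: "p \<in> mod_hom R (free_mod R n) L"
      "p ` carrier (free_mod R n) = carrier L" "finite S" "S \<subseteq> carrier (free_mod R n)"
      "{x \<in> carrier (free_mod R n). p x = \<zero>\<^bsub>L\<^esub>} = mod_span R (free_mod R n) S"
    and L: "left_module R L"
    using assms(1) unfolding fin_presented_def by blast
  interpret L: left_module R L by fact
  have z: "\<tau> \<zero>\<^bsub>L\<^esub> = \<zero>\<^bsub>L'\<^esub>" by (rule mod_hom_zero) fact+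
  have inj: "inj_on \<tau> (carrier L)" and im: "\<tau> ` carrier L = carrier L'"
    using assms(4) by (auto simp: bij_betw_def)
  have "\<tau> (p x) = \<zero>\<^bsub>L'\<^esub> \<longleftrightarrow> p x = \<zero>\<^bsub>L\<^esub>" if "x \<in> carrier (free_mod R n)" for x
    using inj_on_eq_iff[OF inj, of "p x" "\<zero>\<^bsub>L\<^esub>"] mod_homD(1)[OF p(1) that] z by simp
  then have "{x \<in> carrier (free_mod R n). \<tau> (p x) = \<zero>\<^bsub>L'\<^esub>} = mod_span R (free_mod R n) S"
    using p(5) by blast
  moreover have "(\<lambda>x. \<tau> (p x)) ` carrier (free_mod R n) = carrier L'"
    using p(2) im by (metis image_image)
  ultimately show ?thesis
    unfolding fin_presented_def using assms(2) mod_hom_comp[OF p(1) assms(3)] p(3,4) by blast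
qed

lemma fin_presented_copy:
  fixes L :: "('r, 'l, 'y) module_scheme"
  assumes "fin_presented R L"
  obtains L' :: "('r, 'r fp_carrier) module" and \<tau> \<sigma>
  where "fin_presented R L'" "\<tau> \<in> mod_hom R L L'" "\<sigma> \<in> mod_hom R L' L"
    "\<And>x. x \<in> carrier L \<Longrightarrow> \<sigma> (\<tau> x) = x" "\<And>y. y \<in> carrier L' \<Longrightarrow> \<tau> (\<sigma> y) = y"
proof -
  obtain n p where p: "p \<in> mod_hom R (free_mod R n) L"
      "p ` carrier (free_mod R n) = carrier L" and L: "left_module R L"
    using assms(1) unfolding fin_presented_def by blast
  define \<tau> where "\<tau> y = {x \<in> carrier (free_mod R n). p x = y}" for y
  have inj: "inj_on \<tau> (carrier L)"
  proof (rule inj_onI)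
    fix y y' assume "y \<in> carrier L" "\<tau> y = \<tau> y'"
    moreover then obtain x where "x \<in> carrier (free_mod R n)" "p x = y"
      using p(2) by (metis imageE)
    ultimately show "y = y'" unfolding \<tau>_def by blast
  qed
  show thesis
  proof (rule left_module_copy[OF L inj])
    fix L' :: "('r, 'r fp_carrier) module" and \<sigma>
    assume L': "left_module R L'" "carrier L' = \<tau> ` carrier L" "\<tau> \<in> mod_hom R L L'"
      "\<sigma> \<in> mod_hom R L' L" "\<And>x. x \<in> carrier L \<Longrightarrow> \<sigma> (\<tau> x) = x"
      "\<And>y. y \<in> carrier L' \<Longrightarrow> \<tau> (\<sigma> y) = y"
    have "bij_betw \<tau> (carrier L) (carrier L')"
      unfolding bij_betw_def using inj L'(2) by simp
    then have "fin_presented R L'"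
      by (rule fin_presented_iso[OF assms L'(1,3)])
    then show thesis by (rule that) (use L' in simp_all)
  qed
qed

text \<open>The universal property of \<open>R\<^sup>n\<close>, in the form of a lifting property.\<close>

lemma free_mod_lift:
  fixes A :: "('r, 'a, 'x) module_scheme" and B :: "('r, 'b, 'y) module_scheme"
  assumes "left_module R A" "left_module R B" "e \<in> mod_hom R A B" "e ` carrier A = carrier B"
    and "f \<in> mod_hom R (free_mod R n) B"
  shows "\<exists>h \<in> mod_hom R (free_mod R n) A. \<forall>x\<in>carrier (free_mod R n). e (h x) = f x"
  using assms(5)
proof (induction n arbitrary: f)
  case 0
  interpret A: left_module R A by fact
  interpret B: left_module R B by fact
  have c: "carrier (free_mod R 0) = {\<zero>\<^bsub>free_mod R 0\<^esub>}"
    by (auto simp: free_mod_def restrict_def)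
  have lm: "left_module R (free_mod R 0)" by (rule left_module_free_mod[OF A.R.ring_axioms])
  interpret F: left_module R "free_mod R 0" by fact
  have sz: "a \<odot>\<^bsub>A\<^esub> \<zero>\<^bsub>A\<^esub> = \<zero>\<^bsub>A\<^esub>" if "a \<in> carrier R" for a
    using A.smult_r_distr[OF that A.M.zero_closed A.M.zero_closed] that
    by (metis A.M.add.l_cancel_one' A.M.zero_closed A.M.l_zero A.smult_closed)
  have "(\<lambda>_. \<zero>\<^bsub>A\<^esub>) \<in> mod_hom R (free_mod R 0) A"
    by (rule mod_homI) (auto simp: sz)
  moreover have "\<forall>x\<in>carrier (free_mod R 0). e \<zero>\<^bsub>A\<^esub> = f x"
    using mod_hom_zero[OF assms(1,2,3)] mod_hom_zero[OF lm assms(2) 0] c by simp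
  ultimately show ?case by (intro bexI[of _ "\<lambda>_. \<zero>\<^bsub>A\<^esub>"])
next
  case (Suc n)
  interpret A: left_module R A by fact
  interpret B: left_module R B by fact
  let ?F = "free_mod R n" and ?G = "free_mod R (Suc n)"
  define \<iota> where "\<iota> x = (\<lambda>i\<in>{..<Suc n}. if i < n then x i else \<zero>\<^bsub>R\<^esub>)" for x :: "nat \<Rightarrow> 'r"
  define \<pi> where "\<pi> x = (\<lambda>i\<in>{..<n}. x i)" for x :: "nat \<Rightarrow> 'r"
  define b where "b = (\<lambda>i\<in>{..<Suc n}. if i < n then \<zero>\<^bsub>R\<^esub> else \<one>\<^bsub>R\<^esub>)"
  have \<iota>: "\<iota> \<in> mod_hom R ?F ?G"
    by (rule mod_homI) (auto simp: free_mod_def \<iota>_def fun_eq_iff PiE_iff restrict_def extensional_def)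
  have \<pi>: "\<pi> \<in> mod_hom R ?G ?F"
    by (rule mod_homI) (auto simp: free_mod_def \<pi>_def fun_eq_iff PiE_iff restrict_def extensional_def)
  have b: "b \<in> carrier ?G" by (auto simp: free_mod_def b_def)
  have dec: "x = \<iota> (\<pi> x) \<oplus>\<^bsub>?G\<^esub> x n \<odot>\<^bsub>?G\<^esub> b" and xn: "x n \<in> carrier R" if "x \<in> carrier ?G" for x
    using that by (auto simp: free_mod_def \<pi>_def \<iota>_def b_def fun_eq_iff PiE_iff restrict_def
        extensional_def less_Suc_eq)
  obtain h where h: "h \<in> mod_hom R ?F A" "\<forall>x\<in>carrier ?F. e (h x) = f (\<iota> x)"
    using Suc.IH[OF mod_hom_comp[OF \<iota> Suc.prems]] by blast
  have "f b \<in> carrier B" using mod_homD(1)[OF Suc.prems b] .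
  then obtain a where a: "a \<in> carrier A" "e a = f b" using assms(4) by (metis imageE)
  let ?h = "\<lambda>x. h (\<pi> x) \<oplus>\<^bsub>A\<^esub> x n \<odot>\<^bsub>A\<^esub> a"
  note hp = mod_homD[OF mod_hom_comp[OF \<pi> h(1)]]
  have "?h \<in> mod_hom R ?G A"
  proof (rule mod_homI)
    show "?h x \<in> carrier A" if "x \<in> carrier ?G" for x
      using hp(1)[OF that] xn[OF that] a by simp
  next
    fix x y assume xy: "x \<in> carrier ?G" "y \<in> carrier ?G"
    have "(x \<oplus>\<^bsub>?G\<^esub> y) n = x n \<oplus>\<^bsub>R\<^esub> y n" by (simp add: free_mod_def)
    then show "?h (x \<oplus>\<^bsub>?G\<^esub> y) = ?h x \<oplus>\<^bsub>A\<^esub> ?h y"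
      using hp(1)[OF xy(1)] hp(1)[OF xy(2)] xn[OF xy(1)] xn[OF xy(2)] a
      by (simp add: hp(2)[OF xy] A.smult_l_distr A.M.a_ac)
  next
    fix c x assume c: "c \<in> carrier R" and x: "x \<in> carrier ?G"
    have "(c \<odot>\<^bsub>?G\<^esub> x) n = c \<otimes>\<^bsub>R\<^esub> x n" by (simp add: free_mod_def)
    then show "?h (c \<odot>\<^bsub>?G\<^esub> x) = c \<odot>\<^bsub>A\<^esub> ?h x"
      using hp(1)[OF x] xn[OF x] a c
      by (simp add: hp(3)[OF c x] A.smult_r_distr A.smult_assoc1)
  qed
  moreover have "\<forall>x\<in>carrier ?G. e (?h x) = f x"
  proof
    fix x assume x: "x \<in> carrier ?G"
    interpret G: left_module R ?G by (rule left_module_free_mod[OF A.R.ring_axioms])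
    have px: "\<pi> x \<in> carrier ?F" using mod_homD(1)[OF \<pi> x] .
    have "e (?h x) = f (\<iota> (\<pi> x)) \<oplus>\<^bsub>B\<^esub> x n \<odot>\<^bsub>B\<^esub> f b"
      using hp(1)[OF x] xn[OF x] a h(2) px by (simp add: mod_homD[OF assms(3)])
    also have "\<dots> = f (\<iota> (\<pi> x) \<oplus>\<^bsub>?G\<^esub> x n \<odot>\<^bsub>?G\<^esub> b)"
      using mod_homD(1)[OF \<iota> px] xn[OF x] b by (simp add: mod_homD[OF Suc.prems])
    finally show "e (?h x) = f x" using dec[OF x] by simp
  qed
  ultimately show ?case by (intro bexI[of _ ?h])
qed

lemma fp_projective_lift:
  fixes P :: "('r, 'p, 'z) module_scheme"
    and A :: "('r, 'a, 'x) module_scheme" and B :: "('r, 'b, 'y) module_scheme"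
  assumes P: "fp_projective R P"
    and AB: "left_module R A" "left_module R B" "e \<in> mod_hom R A B" "e ` carrier A = carrier B"
    and f: "f \<in> mod_hom R P B"
  shows "\<exists>h \<in> mod_hom R P A. \<forall>x\<in>carrier P. e (h x) = f x"
proof -
  have fp: "fin_presented R P" using P by (simp add: fp_projective_def)
  obtain n p where p: "p \<in> mod_hom R (free_mod R n) P" "p ` carrier (free_mod R n) = carrier P"
    using fp unfolding fin_presented_def by blast
  obtain P' :: "('r, 'r fp_carrier) module" and \<tau> \<sigma> where P': "fin_presented R P'"
      "\<tau> \<in> mod_hom R P P'" "\<sigma> \<in> mod_hom R P' P"
      "\<And>x. x \<in> carrier P \<Longrightarrow> \<sigma> (\<tau> x) = x" "\<And>y. y \<in> carrier P' \<Longrightarrow> \<tau> (\<sigma> y) = y"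
    by (rule fin_presented_copy[OF fp]) (rule that)
  have "ring R" using AB(1) by (simp add: left_module_def)
  obtain c :: "(nat \<Rightarrow> 'r) \<Rightarrow> 'r fp_carrier" where c: "inj c"
    by (rule that[of "\<lambda>x. {x}"]) (simp add: inj_def)
  have injc: "inj_on c (carrier (free_mod R n))"
    using c by (rule inj_on_subset) simp
  obtain F' :: "('r, 'r fp_carrier) module" and s where F': "left_module R F'"
      "carrier F' = c ` carrier (free_mod R n)"
      "c \<in> mod_hom R (free_mod R n) F'" "s \<in> mod_hom R F' (free_mod R n)"
      "\<And>x. x \<in> carrier (free_mod R n) \<Longrightarrow> s (c x) = x"
    by (rule left_module_copy[OF left_module_free_mod[OF \<open>ring R\<close>] injc]) (rule that)
  let ?q = "\<lambda>x. \<tau> (p (s x))"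
  have q: "?q \<in> mod_hom R F' P'"
    by (intro mod_hom_comp[OF mod_hom_comp[OF F'(4) p(1)] P'(2)])
  have "?q ` carrier F' = \<tau> ` p ` carrier (free_mod R n)"
    by (auto simp: F'(2) image_image F'(5) intro!: image_cong)
  also have "\<dots> = carrier P'"
    unfolding p(2)
  proof
    show "\<tau> ` carrier P \<subseteq> carrier P'" using mod_homD(1)[OF P'(2)] by blast
    show "carrier P' \<subseteq> \<tau> ` carrier P"
    proof
      fix y assume "y \<in> carrier P'"
      then show "y \<in> \<tau> ` carrier P"
        using P'(5)[of y] mod_homD(1)[OF P'(3), of y] by (intro image_eqI[of _ _ "\<sigma> y"]) simp_all
    qed
  qed
  finally have qs: "?q ` carrier F' = carrier P'" .
  have lift: "\<exists>h \<in> mod_hom R P A. \<forall>x\<in>carrier P. e (h x) = f x"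
    if "left_module R A" "left_module R B" "e \<in> mod_hom R A B" "e ` carrier A = carrier B"
      "f \<in> mod_hom R P B" for A B :: "('r, 'r fp_carrier) module" and e f
    using P that unfolding fp_projective_def by blast
  have "left_module R P'" using P'(1) by (simp add: fin_presented_def)
  then obtain t where t: "t \<in> mod_hom R P F'" "\<forall>x\<in>carrier P. ?q (t x) = \<tau> x"
    using lift[OF F'(1) _ q qs P'(2)] by blast
  have pt: "p (s (t x)) = x" if x: "x \<in> carrier P" for x
  proof -
    have "p (s (t x)) \<in> carrier P"
      by (rule mod_homD(1)[OF mod_hom_comp[OF F'(4) p(1)] mod_homD(1)[OF t(1) x]])
    then have "p (s (t x)) = \<sigma> (\<tau> (p (s (t x))))" by (simp add: P'(4))
    also have "\<dots> = \<sigma> (\<tau> x)" using t(2) x by simp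
    finally show ?thesis using P'(4)[OF x] by simp
  qed
  obtain h where h: "h \<in> mod_hom R (free_mod R n) A"
      "\<forall>x\<in>carrier (free_mod R n). e (h x) = f (p x)"
    using free_mod_lift[OF AB mod_hom_comp[OF p(1) f]] by blast
  have "(\<lambda>x. h (s (t x))) \<in> mod_hom R P A"
    by (intro mod_hom_comp[OF mod_hom_comp[OF t(1) F'(4)] h(1)])
  moreover have "\<forall>x\<in>carrier P. e (h (s (t x))) = f x"
    using h(2) mod_homD(1)[OF F'(4) mod_homD(1)[OF t(1)]] pt by simp
  ultimately show ?thesis by (intro bexI[of _ "\<lambda>x. h (s (t x))"])
qed

lemma phantom_factors:
  fixes L :: "('r, 'l, 'z) module_scheme"
  assumes "phantom R M N f" "fin_presented R L" "g \<in> mod_hom R L M"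
  shows "\<exists>(P :: ('r, 'r fp_carrier) module) u v.
    fp_projective R P \<and> u \<in> mod_hom R L P \<and> v \<in> mod_hom R P N \<and>
    (\<forall>x\<in>carrier L. f (g x) = v (u x))"
proof -
  obtain L' :: "('r, 'r fp_carrier) module" and \<tau> \<sigma> where L': "fin_presented R L'"
      "\<tau> \<in> mod_hom R L L'" "\<sigma> \<in> mod_hom R L' L" "\<And>x. x \<in> carrier L \<Longrightarrow> \<sigma> (\<tau> x) = x"
    by (rule fin_presented_copy[OF assms(2)]) (rule that)
  obtain P :: "('r, 'r fp_carrier) module" and u v where P: "fp_projective R P"
      "u \<in> mod_hom R L' P" "v \<in> mod_hom R P N" "\<forall>x\<in>carrier L'. f (g (\<sigma> x)) = v (u x)"
    using assms(1) L'(1) mod_hom_comp[OF L'(3) assms(3)] unfolding phantom_def by blast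
  have "\<forall>x\<in>carrier L. f (g x) = v (u (\<tau> x))"
    using P(4) L'(4) mod_homD(1)[OF L'(2)] by metis
  with P(1,3) mod_hom_comp[OF L'(2) P(2)] show ?thesis
    by (intro exI[of _ P] exI[of _ "\<lambda>x. u (\<tau> x)"] exI[of _ v] conjI)
qed

end

theory Submission
  imports Defs
begin

text \<open>
  The cover is found by making a phantom morphism first as small and then as large as possible.

  A map \<open>f : M \<rightarrow> N\<close> is phantom if and only if it trivialises finite systems of relations: whenever
  \<open>h : R\<^sup>n \<rightarrow> M\<close> kills a finite set \<open>S\<close>, the map \<open>f \<circ> h\<close> factors as \<open>R\<^sup>n \<rightarrow> R\<^sup>l \<rightarrow> N\<close> with the first
  factor already killing \<open>S\<close> (\<open>phantom_imp_phantom_kernel_zero\<close>, \<open>phantomI\<close>).  From this form one reads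
  off that phantoms to \<open>N\<close> may be composed with any map into their domain, added, and passed to unions
  of chains, both of domains and of submodules by which one divides.

  Call a phantom \<open>f : X \<rightarrow> N\<close> rigid if it does not stay phantom after dividing \<open>X\<close> by a nonzero
  submodule.  By Zorn's lemma every phantom \<open>M \<rightarrow> N\<close> factors over a rigid quotient of \<open>M\<close>
  (\<open>rigid_quotient\<close>).  A map over \<open>N\<close> from a rigid \<open>X\<close> to any phantom is injective
  (\<open>rigid_phantom_inj_on\<close>), because dividing \<open>X\<close> by its kernel leaves a phantom.

  Rigid phantoms have bounded size (\<open>rigid_phantom_embedding\<close>).  For \<open>u \<noteq> v\<close> in \<open>X\<close>, some finite system
  of relations explains why \<open>X\<close> cannot be divided by \<open>R (u - v)\<close>; recording the part of this
  system that lives in \<open>R\<close> and \<open>N\<close> colours the pairs of elements of \<open>X\<close> with few colours.  The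
  systems of \<open>u - v\<close>, \<open>v - w\<close> and \<open>u - w\<close> cannot have the same colour, since
  \<open>(u - v) + (v - w) - (u - w) = 0\<close> would combine them into a nontrivial relation in \<open>X\<close>.  A set with
  such a colouring injects into the subsets of the set of pairs of colours, by the simplest case of
  the Erdos-Rado theorem (\<open>triangle_free_colouring_bound\<close>).

  Hence rigid phantoms can be compared inside one sufficiently large type, and Zorn's lemma gives one,
  \<open>f : X \<rightarrow> N\<close>, that has no proper rigid extension.  Every map over \<open>N\<close> from \<open>X\<close> to a rigid phantom is
  then bijective (\<open>maximal_rigid_phantom_absorbs\<close>); in particular endomorphisms of \<open>X\<close> over \<open>N\<close> are
  automorphisms.  If \<open>g : Y \<rightarrow> N\<close> is any phantom and \<open>Q\<close> is a rigid quotient of \<open>X \<oplus> Y \<rightarrow> N\<close>, then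
  \<open>X \<rightarrow> Q\<close> is an isomorphism over \<open>N\<close>, and \<open>Y \<rightarrow> Q \<cong> X\<close> is the factorisation demanded of a cover.
  The cover is surjective since each map \<open>R \<rightarrow> N\<close> is phantom and so factors through it.
\<close>

section \<open>Colourings of pairs without monochromatic triangles\<close>

text \<open>
  The Erdos-Rado tree argument.  Well-order \<open>X\<close> and let the path of \<open>x\<close> consist, recursively, of those
  \<open>y < x\<close> which no earlier member \<open>z\<close> of the path distinguishes from \<open>x\<close>, in the sense that
  \<open>c z y = c z x\<close>.  Without monochromatic triangles, distinct members \<open>y\<close> of the path have distinct colours
  \<open>c y x\<close>, so the path with its order is encoded by a relation on colours; and this relation
  determines \<open>x\<close>.
\<close>
lemma triangle_free_colouring_bound:
  fixes c :: "'a \<Rightarrow> 'a \<Rightarrow> 'd" and X :: "'a set"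
  assumes no_triangle: "\<And>u v w. \<lbrakk>u \<in> X; v \<in> X; w \<in> X; u \<noteq> v; v \<noteq> w; u \<noteq> w;
      c u v = c u w; c v w = c u w\<rbrakk> \<Longrightarrow> False"
  shows "\<exists>\<iota> :: 'a \<Rightarrow> ('d \<times> 'd) set. inj_on \<iota> X"
proof -
  obtain r where r: "well_order_on X r" using well_order_on by blast
  define s where "s = r - Id"
  have wf: "wf s" using r by (simp add: s_def well_order_on_def)
  have tr: "trans s"
    using r unfolding s_def well_order_on_def linear_order_on_def partial_order_on_def preorder_on_def
    by (metis trans_diff_Id)
  have sX: "x \<in> X \<and> y \<in> X" if "(x, y) \<in> s" for x y
    using that r unfolding s_def well_order_on_def linear_order_on_def partial_order_on_def
      preorder_on_def by auto
  have tot: "(x, y) \<in> s \<or> (y, x) \<in> s" if "x \<in> X" "y \<in> X" "x \<noteq> y" for x y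
    using that r unfolding s_def well_order_on_def linear_order_on_def total_on_def by auto
  have irr: "(x, x) \<notin> s" for x by (simp add: s_def)
  \<comment> \<open>\<open>p x y\<close> says that \<open>y\<close> lies on the path of \<open>x\<close>.\<close>
  define p where "p x = wfrec s (\<lambda>q y. (y, x) \<in> s \<and> (\<forall>z. (z, y) \<in> s \<and> q z \<longrightarrow> c z y = c z x))" for x
  have p: "p x y \<longleftrightarrow> (y, x) \<in> s \<and> (\<forall>z. (z, y) \<in> s \<and> p x z \<longrightarrow> c z y = c z x)" for x y
    unfolding p_def by (subst wfrec[OF wf]) (auto simp: cut_apply)
  have below: "p y z \<longleftrightarrow> p x z \<and> (z, y) \<in> s" if xy: "p x y" for x y z
    using wf
  proof (induction z)
    case (less z)
    show ?case
    proof (cases "(z, y) \<in> s")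
      case True
      have "(z, x) \<in> s" using True xy p[of x y] tr by (meson transD)
      moreover have "(p y z' \<longrightarrow> c z' z = c z' y) \<longleftrightarrow> (p x z' \<longrightarrow> c z' z = c z' x)" if "(z', z) \<in> s" for z'
      proof -
        have "(z', y) \<in> s" using that True tr by (meson transD)
        moreover from this have "p x z' \<Longrightarrow> c z' y = c z' x" using xy p[of x y] by blast
        ultimately show ?thesis using less[OF that] by auto
      qed
      ultimately show ?thesis unfolding p[of y z] p[of x z] using True by blast
    qed (use p[of y z] in blast)
  qed
  have inj: "z = y" if "p x y" "p x z" "c z x = c y x" for x y z
  proof (rule ccontr)
    have *: False if "p x y" "p x z" "c z x = c y x" "(z, y) \<in> s" for y z
    proof -
      have "c z y = c z x" using that p[of x y] by blast
      moreover have "(y, x) \<in> s" "(z, x) \<in> s" using that p by blast+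
      ultimately show False using no_triangle[of z y x] that sX irr by metis
    qed
    assume "z \<noteq> y"
    moreover have "y \<in> X" "z \<in> X" using that p sX by blast+
    ultimately show False using *[of y z] *[of z y] that tot[of z y] by auto
  qed
  \<comment> \<open>If \<open>y < y'\<close> had the same path and colours, \<open>y\<close> itself would be on the path of \<open>y'\<close>, hence on its own.\<close>
  have determined: "y = y'"
    if "y \<in> X" "y' \<in> X" "\<And>z. p y z \<longleftrightarrow> p y' z" "\<And>z. p y z \<Longrightarrow> c z y = c z y'" for y y'
  proof (rule ccontr)
    have *: False if "(y, y') \<in> s" "\<And>z. p y z \<longleftrightarrow> p y' z" "\<And>z. p y z \<Longrightarrow> c z y = c z y'" for y y'
      using p[of y' y] p[of y y] irr that by blast
    assume "y \<noteq> y'"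
    then show False using *[of y y'] *[of y' y] that tot by metis
  qed
  \<comment> \<open>The diagonal pairs record the set of colours, the others the order in which they occur.\<close>
  define \<iota> where "\<iota> x = {(c z x, c y x) | z y. p x z \<and> p x y \<and> (z = y \<or> (z, y) \<in> s)}" for x
  have \<iota>: "(c z x, c y x) \<in> \<iota> x" if "p x z" "p x y" "z = y \<or> (z, y) \<in> s" for x y z
    using that by (auto simp: \<iota>_def)
  have same: "p x' y \<and> c y x = c y x'" if eq: "\<iota> x = \<iota> x'" and "p x y" for x x' y
    using wf \<open>p x y\<close>
  proof (induction y)
    case (less y)
    \<comment> \<open>Match \<open>y\<close> with the member \<open>y'\<close> of the other path of the same colour; by induction both have the same predecessors.\<close>
    have "(c y x, c y x) \<in> \<iota> x'" using \<iota>[of x y y] less.prems eq by simp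
    then obtain y' where y': "p x' y'" "c y' x' = c y x" by (auto simp: \<iota>_def)
    have forth: "p y' z \<and> c z y = c z y'" if z: "p y z" for z
    proof -
      have xz: "p x z" "(z, y) \<in> s" using below[OF less.prems] z by auto
      then have IH: "p x' z" "c z x = c z x'" using less.IH by auto
      have "(c z x, c y x) \<in> \<iota> x'" using \<iota>[of x z y] less.prems xz eq by simp
      then obtain w v where wv: "p x' w" "p x' v" "c w x' = c z x" "c v x' = c y x" "w = v \<or> (w, v) \<in> s"
        by (auto simp: \<iota>_def)
      have "w = z" "v = y'" using inj[of x'] wv IH y' by auto
      moreover have "z \<noteq> y'" using y' IH inj[OF less.prems xz(1)] xz(2) irr by auto
      ultimately have "(z, y') \<in> s" using wv by auto
      then have "p y' z" "c z y' = c z x'" using below[OF y'(1)] IH p[of x' y'] y' by auto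
      moreover have "c z y = c z x" using less.prems xz p[of x y] by blast
      ultimately show ?thesis using IH by simp
    qed
    have conv: "p y z" if z: "p y' z" for z
    proof -
      have xz: "p x' z" "(z, y') \<in> s" using below[OF y'(1)] z by auto
      have "(c z x', c y' x') \<in> \<iota> x" using \<iota>[of x' z y'] y' xz eq by simp
      then obtain w v where wv: "p x w" "p x v" "c w x = c z x'" "c v x = c y' x'" "w = v \<or> (w, v) \<in> s"
        by (auto simp: \<iota>_def)
      have v: "v = y" using inj[OF less.prems wv(2)] wv y' by simp
      have "w \<noteq> v" using wv inj[OF y'(1) xz(1)] xz(2) irr by auto
      then have wy: "(w, y) \<in> s" using wv v by simp
      then have "p x' w" "c w x = c w x'" using less.IH wv by auto
      then have "w = z" using inj[OF xz(1) \<open>p x' w\<close>] wv(3) by metis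
      then show ?thesis using below[OF less.prems] wv wy by simp
    qed
    have "(y, x) \<in> s" "(y', x') \<in> s" using less.prems y' p by blast+
    then have "y \<in> X" "y' \<in> X" using sX by auto
    moreover have "p y z \<longleftrightarrow> p y' z" for z using forth conv by blast
    ultimately have "y = y'" using forth by (intro determined) auto
    then show ?case using y' by simp
  qed
  have "inj_on \<iota> X"
  proof (rule inj_onI)
    fix x x' assume x: "x \<in> X" "x' \<in> X" and eq: "\<iota> x = \<iota> x'"
    have "p x z \<longleftrightarrow> p x' z" for z using same[OF eq] same[OF eq[symmetric]] by blast
    then show "x = x'" using x same[OF eq] by (intro determined) auto
  qed
  then show ?thesis by blast
qed

section \<open>Homomorphisms, submodules and quotients\<close>

context left_module
begin

lemma smult_zero_right: "a \<in> carrier R \<Longrightarrow> a \<odot>\<^bsub>M\<^esub> \<zero>\<^bsub>M\<^esub> = \<zero>\<^bsub>M\<^esub>"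
  by (metis M.add.l_cancel_one' M.zero_closed M.l_zero smult_closed smult_r_distr)

lemma smult_zero_left: "x \<in> carrier M \<Longrightarrow> \<zero>\<^bsub>R\<^esub> \<odot>\<^bsub>M\<^esub> x = \<zero>\<^bsub>M\<^esub>"
  by (metis M.add.l_cancel_one' R.zero_closed R.l_zero smult_closed smult_l_distr)

lemma smult_minus_one: "x \<in> carrier M \<Longrightarrow> (\<ominus>\<^bsub>R\<^esub> \<one>\<^bsub>R\<^esub>) \<odot>\<^bsub>M\<^esub> x = \<ominus>\<^bsub>M\<^esub> x"
  using smult_l_distr[of "\<ominus>\<^bsub>R\<^esub> \<one>\<^bsub>R\<^esub>" "\<one>\<^bsub>R\<^esub>" x]
  by (simp add: R.l_neg smult_zero_left M.minus_equality[symmetric])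

lemma submodule_if_closed:
  assumes "T \<subseteq> carrier M" "\<zero>\<^bsub>M\<^esub> \<in> T" "\<And>x y. x \<in> T \<Longrightarrow> y \<in> T \<Longrightarrow> x \<oplus>\<^bsub>M\<^esub> y \<in> T"
    and "\<And>a x. a \<in> carrier R \<Longrightarrow> x \<in> T \<Longrightarrow> a \<odot>\<^bsub>M\<^esub> x \<in> T"
  shows "submodule T R M"
proof (intro submodule.intro subgroup.intro submodule_axioms.intro)
  fix x assume x: "x \<in> T"
  have "(\<ominus>\<^bsub>R\<^esub> \<one>\<^bsub>R\<^esub>) \<odot>\<^bsub>M\<^esub> x \<in> T" using assms(4) x by simp
  then show "inv\<^bsub>add_monoid M\<^esub> x \<in> T"
    using smult_minus_one[of x] x assms(1) by (auto simp: a_inv_def)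
qed (use assms in auto)

end

lemma submoduleD:
  assumes "submodule T R M"
  shows "x \<in> T \<Longrightarrow> x \<in> carrier M" "\<zero>\<^bsub>M\<^esub> \<in> T" "x \<in> T \<Longrightarrow> y \<in> T \<Longrightarrow> x \<oplus>\<^bsub>M\<^esub> y \<in> T"
    "a \<in> carrier R \<Longrightarrow> x \<in> T \<Longrightarrow> a \<odot>\<^bsub>M\<^esub> x \<in> T" "x \<in> T \<Longrightarrow> \<ominus>\<^bsub>M\<^esub> x \<in> T"
proof -
  have s: "subgroup T (add_monoid M)" using assms by (rule submodule.axioms(1))
  show "x \<in> T \<Longrightarrow> x \<in> carrier M" "\<zero>\<^bsub>M\<^esub> \<in> T" "x \<in> T \<Longrightarrow> y \<in> T \<Longrightarrow> x \<oplus>\<^bsub>M\<^esub> y \<in> T"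
    using subgroup.mem_carrier[OF s] subgroup.one_closed[OF s] subgroup.m_closed[OF s] by auto
  show "x \<in> T \<Longrightarrow> \<ominus>\<^bsub>M\<^esub> x \<in> T"
    using subgroup.m_inv_closed[OF s] by (simp add: a_inv_def)
  show "a \<in> carrier R \<Longrightarrow> x \<in> T \<Longrightarrow> a \<odot>\<^bsub>M\<^esub> x \<in> T"
    using submodule.smult_closed[OF assms] .
qed

lemma submodule_zero:
  assumes "left_module R M" shows "submodule {\<zero>\<^bsub>M\<^esub>} R M"
proof -
  interpret M: left_module R M by fact
  show ?thesis by (rule M.submodule_if_closed) (auto simp: M.smult_zero_right)
qed

lemma submodule_cyclic:
  assumes "left_module R M" "t \<in> carrier M" shows "submodule {a \<odot>\<^bsub>M\<^esub> t |a. a \<in> carrier R} R M"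
proof -
  interpret M: left_module R M by fact
  show ?thesis
  proof (rule M.submodule_if_closed)
    show "\<zero>\<^bsub>M\<^esub> \<in> {a \<odot>\<^bsub>M\<^esub> t |a. a \<in> carrier R}"
      using M.smult_zero_left[OF assms(2)] M.R.zero_closed by (metis (mono_tags, lifting) mem_Collect_eq)
  next
    fix x y assume "x \<in> {a \<odot>\<^bsub>M\<^esub> t |a. a \<in> carrier R}" "y \<in> {a \<odot>\<^bsub>M\<^esub> t |a. a \<in> carrier R}"
    then obtain a b where "x = a \<odot>\<^bsub>M\<^esub> t" "y = b \<odot>\<^bsub>M\<^esub> t" "a \<in> carrier R" "b \<in> carrier R" by auto
    then have "x \<oplus>\<^bsub>M\<^esub> y = (a \<oplus>\<^bsub>R\<^esub> b) \<odot>\<^bsub>M\<^esub> t" "a \<oplus>\<^bsub>R\<^esub> b \<in> carrier R"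
      using assms(2) by (simp_all add: M.smult_l_distr)
    then show "x \<oplus>\<^bsub>M\<^esub> y \<in> {a \<odot>\<^bsub>M\<^esub> t |a. a \<in> carrier R}" by blast
  next
    fix b x assume "b \<in> carrier R" "x \<in> {a \<odot>\<^bsub>M\<^esub> t |a. a \<in> carrier R}"
    then obtain a where "x = a \<odot>\<^bsub>M\<^esub> t" "a \<in> carrier R" "b \<in> carrier R" by auto
    then have "b \<odot>\<^bsub>M\<^esub> x = (b \<otimes>\<^bsub>R\<^esub> a) \<odot>\<^bsub>M\<^esub> t" "b \<otimes>\<^bsub>R\<^esub> a \<in> carrier R"
      using assms(2) by (simp_all add: M.smult_assoc1)
    then show "b \<odot>\<^bsub>M\<^esub> x \<in> {a \<odot>\<^bsub>M\<^esub> t |a. a \<in> carrier R}" by blast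
  qed (use assms(2) in auto)
qed

lemma submodule_vimage:
  assumes "left_module R M" "left_module R N" "h \<in> mod_hom R M N" "submodule T R N"
  shows "submodule {x \<in> carrier M. h x \<in> T} R M"
proof -
  interpret M: left_module R M by fact
  note T = submoduleD[OF assms(4)] and h = mod_homD[OF assms(3)]
  show ?thesis
    by (rule M.submodule_if_closed)
      (use T h mod_hom_zero[OF assms(1-3)] in auto)
qed

lemma mod_span_submodule:
  assumes "left_module R M" "S \<subseteq> carrier M"
  shows "submodule (mod_span R M S) R M" "S \<subseteq> mod_span R M S"
    "submodule K R M \<Longrightarrow> S \<subseteq> K \<Longrightarrow> mod_span R M S \<subseteq> K"
proof -
  interpret M: left_module R M by fact
  have "submodule (carrier M) R M" by (rule M.submodule_if_closed) auto
  then have "mod_span R M S \<subseteq> carrier M" unfolding mod_span_def using assms(2) by blast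
  then show "submodule (mod_span R M S) R M"
    by (intro M.submodule_if_closed) (auto simp: mod_span_def intro: submoduleD)
qed (auto simp: mod_span_def)

lemma mod_hom_const_zero:
  assumes "left_module R M" "left_module R N" shows "(\<lambda>x. \<zero>\<^bsub>N\<^esub>) \<in> mod_hom R M N"
proof -
  interpret N: left_module R N by fact
  show ?thesis by (rule mod_homI) (auto simp: N.smult_zero_right)
qed

lemma mod_hom_add:
  assumes "left_module R N" "g \<in> mod_hom R M N" "h \<in> mod_hom R M N"
  shows "(\<lambda>x. g x \<oplus>\<^bsub>N\<^esub> h x) \<in> mod_hom R M N"
proof -
  interpret N: left_module R N by fact
  note g = mod_homD[OF assms(2)] and h = mod_homD[OF assms(3)]
  show ?thesis by (rule mod_homI) (simp_all add: g h N.smult_r_distr N.M.a_ac)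
qed

lemma mod_hom_minus:
  assumes "left_module R N" "h \<in> mod_hom R M N"
  shows "(\<lambda>x. \<ominus>\<^bsub>N\<^esub> h x) \<in> mod_hom R M N"
proof -
  interpret N: left_module R N by fact
  note h = mod_homD[OF assms(2)]
  have "a \<odot>\<^bsub>N\<^esub> (\<ominus>\<^bsub>N\<^esub> y) = \<ominus>\<^bsub>N\<^esub> (a \<odot>\<^bsub>N\<^esub> y)" if "a \<in> carrier R" "y \<in> carrier N" for a y
    using N.smult_r_distr[of a "\<ominus>\<^bsub>N\<^esub> y" y] that
    by (simp add: N.M.l_neg N.smult_zero_right N.M.minus_equality)
  then show ?thesis by (intro mod_homI) (simp_all add: h N.M.minus_add)
qed

lemma mod_hom_uminus:
  assumes "left_module R M" "left_module R N" "h \<in> mod_hom R M N" "x \<in> carrier M"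
  shows "h (\<ominus>\<^bsub>M\<^esub> x) = \<ominus>\<^bsub>N\<^esub> h x"
proof -
  interpret M: left_module R M by fact
  interpret N: left_module R N by fact
  show ?thesis
    using mod_homD(3)[OF assms(3), of "\<ominus>\<^bsub>R\<^esub> \<one>\<^bsub>R\<^esub>" x] mod_homD(1)[OF assms(3,4)] assms(4)
    by (simp add: M.smult_minus_one N.smult_minus_one)
qed

text \<open>
  The type \<open>'m set\<close> of the quotient matters: it is determined by that of \<open>M\<close>, so that quotients
  can be formed without leaving the types over which later statements range.
\<close>
lemma quotient_module:
  fixes M :: "('r, 'm, 'y) module_scheme"
  assumes "left_module R M" "submodule T R M"
  obtains Q :: "('r, 'm set) module" and q
  where "left_module R Q" "q \<in> mod_hom R M Q" "q ` carrier M = carrier Q"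
    "\<And>x. x \<in> carrier M \<Longrightarrow> q x = \<zero>\<^bsub>Q\<^esub> \<longleftrightarrow> x \<in> T"
proof -
  interpret M: left_module R M by fact
  note T = submoduleD[OF assms(2)]
  \<comment> \<open>\<open>q x\<close> is the coset of \<open>x\<close>.\<close>
  define q where "q x = {y \<in> carrier M. y \<oplus>\<^bsub>M\<^esub> \<ominus>\<^bsub>M\<^esub> x \<in> T}" for x
  have eq: "q x = q y \<longleftrightarrow> x \<oplus>\<^bsub>M\<^esub> \<ominus>\<^bsub>M\<^esub> y \<in> T" if x: "x \<in> carrier M" and y: "y \<in> carrier M" for x y
  proof
    assume "q x = q y"
    moreover have "x \<in> q x" using x T(2) by (simp add: q_def M.M.r_neg)
    ultimately show "x \<oplus>\<^bsub>M\<^esub> \<ominus>\<^bsub>M\<^esub> y \<in> T" by (simp add: q_def)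
  next
    have step: "q x \<subseteq> q y" if x: "x \<in> carrier M" and y: "y \<in> carrier M" and xy: "x \<oplus>\<^bsub>M\<^esub> \<ominus>\<^bsub>M\<^esub> y \<in> T" for x y
    proof
      fix z assume z: "z \<in> q x"
      then have "(z \<oplus>\<^bsub>M\<^esub> \<ominus>\<^bsub>M\<^esub> x) \<oplus>\<^bsub>M\<^esub> (x \<oplus>\<^bsub>M\<^esub> \<ominus>\<^bsub>M\<^esub> y) \<in> T" using T(3) xy by (simp add: q_def)
      also have "(z \<oplus>\<^bsub>M\<^esub> \<ominus>\<^bsub>M\<^esub> x) \<oplus>\<^bsub>M\<^esub> (x \<oplus>\<^bsub>M\<^esub> \<ominus>\<^bsub>M\<^esub> y) = z \<oplus>\<^bsub>M\<^esub> \<ominus>\<^bsub>M\<^esub> y"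
        using x y z by (simp add: q_def M.M.a_assoc M.M.r_neg1)
      finally show "z \<in> q y" using z by (simp add: q_def)
    qed
    assume xy: "x \<oplus>\<^bsub>M\<^esub> \<ominus>\<^bsub>M\<^esub> y \<in> T"
    have "\<ominus>\<^bsub>M\<^esub> (x \<oplus>\<^bsub>M\<^esub> \<ominus>\<^bsub>M\<^esub> y) = y \<oplus>\<^bsub>M\<^esub> \<ominus>\<^bsub>M\<^esub> x"
      using x y by (simp add: M.M.minus_add M.M.a_comm)
    then have "y \<oplus>\<^bsub>M\<^esub> \<ominus>\<^bsub>M\<^esub> x \<in> T" using T(5)[OF xy] by simp
    with xy show "q x = q y" using step[OF x y] step[OF y x] by blast
  qed
  define r where "r = inv_into (carrier M) q"
  have rc: "r (q x) \<in> carrier M" and qr: "q (r (q x)) = q x" if "x \<in> carrier M" for x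
    using that inv_into_into[of "q x" q "carrier M"] f_inv_into_f[of "q x" q "carrier M"]
    by (auto simp: r_def)
  define Q :: "('r, 'm set) module" where "Q =
    \<lparr>carrier = q ` carrier M, mult = undefined, one = undefined, zero = q \<zero>\<^bsub>M\<^esub>,
     add = (\<lambda>x y. q (r x \<oplus>\<^bsub>M\<^esub> r y)), smult = (\<lambda>a x. q (a \<odot>\<^bsub>M\<^esub> r x))\<rparr>"
  have qadd: "q (r (q x) \<oplus>\<^bsub>M\<^esub> r (q y)) = q (x \<oplus>\<^bsub>M\<^esub> y)" if x: "x \<in> carrier M" and y: "y \<in> carrier M" for x y
  proof -
    let ?x = "r (q x)" and ?y = "r (q y)"
    have "(?x \<oplus>\<^bsub>M\<^esub> \<ominus>\<^bsub>M\<^esub> x) \<oplus>\<^bsub>M\<^esub> (?y \<oplus>\<^bsub>M\<^esub> \<ominus>\<^bsub>M\<^esub> y) \<in> T"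
      using eq[OF rc[OF x] x] eq[OF rc[OF y] y] qr x y T(3) by simp
    also have "(?x \<oplus>\<^bsub>M\<^esub> \<ominus>\<^bsub>M\<^esub> x) \<oplus>\<^bsub>M\<^esub> (?y \<oplus>\<^bsub>M\<^esub> \<ominus>\<^bsub>M\<^esub> y) = (?x \<oplus>\<^bsub>M\<^esub> ?y) \<oplus>\<^bsub>M\<^esub> \<ominus>\<^bsub>M\<^esub> (x \<oplus>\<^bsub>M\<^esub> y)"
      using rc x y by (simp add: M.M.minus_add M.M.a_ac)
    finally show ?thesis using eq[of "?x \<oplus>\<^bsub>M\<^esub> ?y" "x \<oplus>\<^bsub>M\<^esub> y"] rc x y by simp
  qed
  have qsm: "q (a \<odot>\<^bsub>M\<^esub> r (q x)) = q (a \<odot>\<^bsub>M\<^esub> x)" if a: "a \<in> carrier R" and x: "x \<in> carrier M" for a x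
  proof -
    let ?x = "r (q x)"
    have "a \<odot>\<^bsub>M\<^esub> (?x \<oplus>\<^bsub>M\<^esub> \<ominus>\<^bsub>M\<^esub> x) \<in> T"
      using eq[OF rc[OF x] x] qr x a T(4) by simp
    also have "a \<odot>\<^bsub>M\<^esub> (?x \<oplus>\<^bsub>M\<^esub> \<ominus>\<^bsub>M\<^esub> x) = a \<odot>\<^bsub>M\<^esub> ?x \<oplus>\<^bsub>M\<^esub> \<ominus>\<^bsub>M\<^esub> (a \<odot>\<^bsub>M\<^esub> x)"
    proof -
      have "(\<lambda>x. x) \<in> mod_hom R M M" by (rule mod_homI) auto
      from mod_homD(3)[OF mod_hom_minus[OF assms(1) this] a x]
      show ?thesis using rc x a by (simp add: M.smult_r_distr)
    qed
    finally show ?thesis using eq[of "a \<odot>\<^bsub>M\<^esub> ?x" "a \<odot>\<^bsub>M\<^esub> x"] rc x a by simp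
  qed
  have "abelian_group Q"
  proof (rule abelian_groupI)
    fix x assume x: "x \<in> carrier Q"
    then obtain x0 where x0: "x0 \<in> carrier M" "x = q x0" by (auto simp: Q_def)
    then show "\<exists>y\<in>carrier Q. y \<oplus>\<^bsub>Q\<^esub> x = \<zero>\<^bsub>Q\<^esub>"
      by (intro bexI[of _ "q (\<ominus>\<^bsub>M\<^esub> x0)"]) (auto simp: Q_def qadd M.M.l_neg)
  qed (auto simp: Q_def qadd rc M.M.a_ac)
  then have lm: "left_module R Q"
    by (intro left_module.intro left_module_axioms.intro M.R.ring_axioms)
      ((clarsimp simp: Q_def qadd qsm qr rc, (simp add: M.smult_l_distr M.smult_r_distr M.smult_assoc1)?)+)
  show thesis
  proof (rule that[OF lm, of q])
    show "q x = \<zero>\<^bsub>Q\<^esub> \<longleftrightarrow> x \<in> T" if "x \<in> carrier M" for x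
      using eq[OF that M.M.zero_closed] that M.M.minus_equality[of "\<zero>\<^bsub>M\<^esub>" "\<zero>\<^bsub>M\<^esub>"]
      by (simp add: Q_def)
  qed (auto simp: Q_def qadd qsm intro!: mod_homI)
qed

lemma mod_hom_factor_surj:
  assumes "left_module R M" "left_module R Q" "left_module R N"
    and "q \<in> mod_hom R M Q" "q ` carrier M = carrier Q" "f \<in> mod_hom R M N"
    and ker: "\<And>x. x \<in> carrier M \<Longrightarrow> q x = \<zero>\<^bsub>Q\<^esub> \<Longrightarrow> f x = \<zero>\<^bsub>N\<^esub>"
  obtains f' where "f' \<in> mod_hom R Q N" "\<And>x. x \<in> carrier M \<Longrightarrow> f' (q x) = f x"
proof -
  interpret M: left_module R M by fact
  interpret Q: left_module R Q by fact
  interpret N: left_module R N by fact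
  note q = mod_homD[OF assms(4)] and f = mod_homD[OF assms(6)]
  have eq: "f x = f y" if x: "x \<in> carrier M" and y: "y \<in> carrier M" and "q x = q y" for x y
  proof -
    have "q (x \<oplus>\<^bsub>M\<^esub> \<ominus>\<^bsub>M\<^esub> y) = \<zero>\<^bsub>Q\<^esub>"
      using that q mod_hom_uminus[OF assms(1,2,4) y] by (simp add: Q.M.r_neg)
    then have "f (x \<oplus>\<^bsub>M\<^esub> \<ominus>\<^bsub>M\<^esub> y) = \<zero>\<^bsub>N\<^esub>" using ker x y by simp
    then have "f x \<oplus>\<^bsub>N\<^esub> \<ominus>\<^bsub>N\<^esub> f y = \<zero>\<^bsub>N\<^esub>"
      using f x y mod_hom_uminus[OF assms(1,3,6) y] by simp
    then show ?thesis using f(1)[OF x] f(1)[OF y]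
      by (metis N.M.add.inv_closed N.M.minus_equality N.M.minus_minus)
  qed
  define f' where "f' = f \<circ> inv_into (carrier M) q"
  have f': "f' (q x) = f x" if "x \<in> carrier M" for x
    unfolding f'_def comp_def
    by (rule eq) (use that in \<open>auto intro: inv_into_into f_inv_into_f\<close>)
  have "f' \<in> mod_hom R Q N"
  proof (rule mod_homI)
    fix x assume "x \<in> carrier Q"
    then obtain x0 where "x0 \<in> carrier M" "x = q x0" using assms(5) by blast
    then show "f' x \<in> carrier N" "\<And>a. a \<in> carrier R \<Longrightarrow> f' (a \<odot>\<^bsub>Q\<^esub> x) = a \<odot>\<^bsub>N\<^esub> f' x"
      by (auto simp: f' f q(3)[symmetric])
    fix y assume "y \<in> carrier Q"
    then obtain y0 where "y0 \<in> carrier M" "y = q y0" using assms(5) by blast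
    then show "f' (x \<oplus>\<^bsub>Q\<^esub> y) = f' x \<oplus>\<^bsub>N\<^esub> f' y"
      using \<open>x0 \<in> carrier M\<close> \<open>x = q x0\<close> by (simp add: f' f q(2)[symmetric])
  qed
  then show thesis using f' that by blast
qed

definition unit_vector :: "('r, 'z) ring_scheme \<Rightarrow> nat \<Rightarrow> nat \<Rightarrow> nat \<Rightarrow> 'r"
  where "unit_vector R n i = (\<lambda>j\<in>{..<n}. if j = i then \<one>\<^bsub>R\<^esub> else \<zero>\<^bsub>R\<^esub>)"

lemma unit_vector_closed: "ring R \<Longrightarrow> unit_vector R n i \<in> carrier (free_mod R n)"
  by (auto simp: unit_vector_def free_mod_def ring.ring_simprules)

lemma unit_vectors_generate:
  assumes "ring R" "submodule K R (free_mod R n)" "\<And>i. i < n \<Longrightarrow> unit_vector R n i \<in> K"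
    and x: "x \<in> carrier (free_mod R n)"
  shows "x \<in> K"
proof -
  interpret R: ring R by fact
  let ?F = "free_mod R n"
  \<comment> \<open>The truncations of \<open>x\<close>, built up one coordinate at a time.\<close>
  define y where "y k = (\<lambda>j\<in>{..<n}. if j < k then x j else \<zero>\<^bsub>R\<^esub>)" for k :: nat
  have "y k \<in> K" if "k \<le> n" for k
    using that
  proof (induction k)
    case 0
    have "y 0 = \<zero>\<^bsub>?F\<^esub>" by (simp add: y_def free_mod_def)
    then show ?case using submoduleD(2)[OF assms(2)] by simp
  next
    case (Suc k)
    have xR: "x j \<in> carrier R" if "j < n" for j using x that by (auto simp: free_mod_def)
    have "y (Suc k) = y k \<oplus>\<^bsub>?F\<^esub> x k \<odot>\<^bsub>?F\<^esub> unit_vector R n k"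
    proof
      fix j
      consider "j < k" | "j = k" | "k < j" by linarith
      then show "y (Suc k) j = (y k \<oplus>\<^bsub>?F\<^esub> x k \<odot>\<^bsub>?F\<^esub> unit_vector R n k) j"
        by cases (use Suc.prems xR in \<open>simp_all add: y_def unit_vector_def free_mod_def\<close>)
    qed
    moreover have "x k \<in> carrier R" using xR Suc.prems by simp
    ultimately show ?case using Suc submoduleD[OF assms(2)] assms(3) by simp
  qed
  moreover have "y n = x"
    using x by (auto simp: y_def free_mod_def fun_eq_iff PiE_iff extensional_def)
  ultimately show ?thesis by auto
qed

lemma free_mod_hom_eqI:
  assumes "left_module R N" "g \<in> mod_hom R (free_mod R n) N" "h \<in> mod_hom R (free_mod R n) N"
    and "\<And>i. i < n \<Longrightarrow> g (unit_vector R n i) = h (unit_vector R n i)"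
    and x: "x \<in> carrier (free_mod R n)"
  shows "g x = h x"
proof -
  interpret N: left_module R N by fact
  have F: "left_module R (free_mod R n)" by (rule left_module_free_mod[OF N.R.ring_axioms])
  interpret F: left_module R "free_mod R n" by fact
  have "submodule {x \<in> carrier (free_mod R n). g x = h x} R (free_mod R n)"
    by (rule F.submodule_if_closed)
      (use mod_hom_zero[OF F assms(1,2)] mod_hom_zero[OF F assms(1,3)]
        mod_homD[OF assms(2)] mod_homD[OF assms(3)] in auto)
  from unit_vectors_generate[OF N.R.ring_axioms this _ x] show ?thesis
    using assms(4) unit_vector_closed[OF N.R.ring_axioms] by auto
qed


section \<open>Phantom morphisms in terms of finite systems of relations\<close>

text \<open>
  A map \<open>w : R\<^sup>n \<rightarrow> N\<close> with \<open>w S = 0\<close> is the same as a map from the finitely presented module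
  \<open>R\<^sup>n / \<langle>S\<rangle>\<close> to \<open>N\<close>.  The following says that this map factors through some \<open>R\<^sup>l\<close>.
\<close>
definition factors_through_free ::
    "('r, 'z) ring_scheme \<Rightarrow> nat \<Rightarrow> (nat \<Rightarrow> 'r) set \<Rightarrow> ('r, 'n, 'y) module_scheme \<Rightarrow> ((nat \<Rightarrow> 'r) \<Rightarrow> 'n) \<Rightarrow> bool"
  where "factors_through_free R n S N w \<longleftrightarrow>
    (\<exists>l. \<exists>u \<in> mod_hom R (free_mod R n) (free_mod R l). \<exists>v \<in> mod_hom R (free_mod R l) N.
       (\<forall>s\<in>S. u s = \<zero>\<^bsub>free_mod R l\<^esub>) \<and> (\<forall>x\<in>carrier (free_mod R n). w x = v (u x)))"

text \<open>
  A submodule \<open>T\<close> such that \<open>f\<close> induces a phantom \<open>M / T \<rightarrow> N\<close>.  Since \<open>R\<^sup>n\<close> is free, maps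
  \<open>R\<^sup>n \<rightarrow> M / T\<close> killing \<open>S\<close> are represented by maps \<open>R\<^sup>n \<rightarrow> M\<close> sending \<open>S\<close> into \<open>T\<close>; stated with
  the latter, the condition involves \<open>T\<close> only through membership of finitely many elements and
  visibly passes to unions of chains.
\<close>
definition phantom_kernel ::
    "('r, 'z) ring_scheme \<Rightarrow> ('r, 'm, 'x) module_scheme \<Rightarrow> ('r, 'n, 'y) module_scheme \<Rightarrow> ('m \<Rightarrow> 'n) \<Rightarrow> 'm set \<Rightarrow> bool"
  where "phantom_kernel R M N f T \<longleftrightarrow> submodule T R M \<and>
    (\<forall>n S h. finite S \<and> S \<subseteq> carrier (free_mod R n) \<and> h \<in> mod_hom R (free_mod R n) M \<and> h ` S \<subseteq> T \<longrightarrow>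
       factors_through_free R n S N (\<lambda>x. f (h x)))"

lemma phantom_kernelD:
  assumes "phantom_kernel R M N f T"
  shows "submodule T R M"
    and "\<lbrakk>finite S; S \<subseteq> carrier (free_mod R n); h \<in> mod_hom R (free_mod R n) M; \<And>s. s \<in> S \<Longrightarrow> h s \<in> T\<rbrakk>
      \<Longrightarrow> factors_through_free R n S N (\<lambda>x. f (h x))"
  using assms unfolding phantom_kernel_def by (blast, simp add: image_subset_iff)

lemma factors_through_freeI:
  assumes "u \<in> mod_hom R (free_mod R n) (free_mod R l)" "v \<in> mod_hom R (free_mod R l) N"
    and "\<And>s. s \<in> S \<Longrightarrow> u s = \<zero>\<^bsub>free_mod R l\<^esub>"
    and "\<And>x. x \<in> carrier (free_mod R n) \<Longrightarrow> w x = v (u x)"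
  shows "factors_through_free R n S N w"
  unfolding factors_through_free_def
  by (intro exI[of _ l] bexI[of _ u] bexI[of _ v] conjI) (use assms in simp_all)

lemma factors_through_free_cong:
  assumes "factors_through_free R n S N w" "\<And>x. x \<in> carrier (free_mod R n) \<Longrightarrow> w x = w' x"
  shows "factors_through_free R n S N w'"
proof -
  obtain l u v where "u \<in> mod_hom R (free_mod R n) (free_mod R l)" "v \<in> mod_hom R (free_mod R l) N"
      "\<forall>s\<in>S. u s = \<zero>\<^bsub>free_mod R l\<^esub>" "\<forall>x\<in>carrier (free_mod R n). w x = v (u x)"
    using assms(1) unfolding factors_through_free_def by blast
  then show ?thesis using assms(2) by (intro factors_through_freeI) simp_all
qed

lemma factors_through_free_relation:
  assumes "ring R" "left_module R N" "factors_through_free R n S N w" "S \<subseteq> carrier (free_mod R n)" "s \<in> S"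
  shows "w s = \<zero>\<^bsub>N\<^esub>"
proof -
  obtain l u v where "v \<in> mod_hom R (free_mod R l) N" "u s = \<zero>\<^bsub>free_mod R l\<^esub>" "w s = v (u s)"
    using assms(3-5) unfolding factors_through_free_def by blast
  then show ?thesis using mod_hom_zero[OF left_module_free_mod[OF assms(1)] assms(2)] by simp
qed

lemma fp_projective_fp: "fp_projective R P \<Longrightarrow> fin_presented R P"
  by (simp add: fp_projective_def)

lemma fp_projective_free_mod:
  assumes "ring R" shows "fp_projective R (free_mod R n)"
proof -
  have F: "left_module R (free_mod R n)" by (rule left_module_free_mod[OF assms])
  have "mod_span R (free_mod R n) {} = {\<zero>\<^bsub>free_mod R n\<^esub>}"
    using mod_span_submodule[OF F, of "{}"] submodule_zero[OF F] submoduleD(2) by blast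
  then have "fin_presented R (free_mod R n)"
    unfolding fin_presented_def
    by (intro conjI F exI[of _ n] exI[of _ "\<lambda>x. x"] exI[of _ "{}"])
      (use submoduleD(2)[OF submodule_zero[OF F]] submoduleD(1)[OF submodule_zero[OF F]] in
        \<open>auto intro!: mod_homI\<close>)
  then show ?thesis
    unfolding fp_projective_def 
    by - (intro conjI allI impI, assumption, elim conjE, rule free_mod_lift)
qed

text \<open>
  Apply the definition to \<open>L = R\<^sup>n / \<langle>S\<rangle>\<close>.  The finitely generated projective module obtained in this
  way is a direct summand of some \<open>R\<^sup>l\<close>, through which the factorisation can be redirected.
\<close>
lemma phantom_imp_phantom_kernel_zero:
  fixes M :: "('r, 'm, 'x) module_scheme" and N :: "('r, 'n, 'y) module_scheme"
  assumes "phantom R M N f"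
  shows "phantom_kernel R M N f {\<zero>\<^bsub>M\<^esub>}"
proof -
  have M: "left_module R M" and N: "left_module R N" and f: "f \<in> mod_hom R M N"
    using assms by (simp_all add: phantom_def)
  interpret M: left_module R M by fact
  have rR: "ring R" by (rule M.R.ring_axioms)
  have "factors_through_free R n S N (\<lambda>x. f (h x))"
    if S: "finite S" "S \<subseteq> carrier (free_mod R n)" and h: "h \<in> mod_hom R (free_mod R n) M"
      and hS: "h ` S \<subseteq> {\<zero>\<^bsub>M\<^esub>}" for n S h
  proof -
    let ?F = "free_mod R n"
    have F: "left_module R ?F" by (rule left_module_free_mod[OF rR])
    note span = mod_span_submodule[OF F S(2)]
    obtain L :: "('r, (nat \<Rightarrow> 'r) set) module" and p where L: "left_module R L"
        "p \<in> mod_hom R ?F L" "p ` carrier ?F = carrier L"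
        "\<And>x. x \<in> carrier ?F \<Longrightarrow> p x = \<zero>\<^bsub>L\<^esub> \<longleftrightarrow> x \<in> mod_span R ?F S"
      by (rule quotient_module[OF F span(1)]) (rule that)
    have "{x \<in> carrier ?F. p x = \<zero>\<^bsub>L\<^esub>} = mod_span R ?F S"
      using L(4) submoduleD(1)[OF span(1)] by blast
    then have fp: "fin_presented R L" using L S unfolding fin_presented_def by blast
    have "mod_span R ?F S \<subseteq> {x \<in> carrier ?F. h x \<in> {\<zero>\<^bsub>M\<^esub>}}"
      by (rule span(3)[OF submodule_vimage[OF F M h submodule_zero[OF M]]]) (use hS S in auto)
    then have ker: "\<And>x. x \<in> carrier ?F \<Longrightarrow> p x = \<zero>\<^bsub>L\<^esub> \<Longrightarrow> h x = \<zero>\<^bsub>M\<^esub>" using L(4) by blast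
    obtain g where g: "g \<in> mod_hom R L M" "\<And>x. x \<in> carrier ?F \<Longrightarrow> g (p x) = h x"
      by (rule mod_hom_factor_surj[OF F L(1) M L(2,3) h ker]) (use that in auto)
    obtain P :: "('r, 'r fp_carrier) module" and u v where P: "fp_projective R P"
        "u \<in> mod_hom R L P" "v \<in> mod_hom R P N" "\<forall>x\<in>carrier L. f (g x) = v (u x)"
      using phantom_factors[OF assms fp g(1)] by blast
    obtain l q where q: "q \<in> mod_hom R (free_mod R l) P" "q ` carrier (free_mod R l) = carrier P"
      and lP: "left_module R P"
      using P(1)[THEN fp_projective_fp] unfolding fin_presented_def by blast
    \<comment> \<open>Lifting the identity along \<open>q\<close> splits the presentation \<open>R\<^sup>l \<rightarrow> P\<close>.\<close>
    have "(\<lambda>x. x) \<in> mod_hom R P P" by (rule mod_homI) auto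
    then obtain t where t: "t \<in> mod_hom R P (free_mod R l)" "\<forall>x\<in>carrier P. q (t x) = x"
      using fp_projective_lift[OF P(1) left_module_free_mod[OF rR] lP q] by blast
    let ?u = "\<lambda>x. t (u (p x))" and ?v = "\<lambda>x. v (q x)"
    note u = mod_hom_comp[OF L(2) P(2)]
    have "?u s = \<zero>\<^bsub>free_mod R l\<^esub>" if "s \<in> S" for s
    proof -
      have "p s = \<zero>\<^bsub>L\<^esub>" using that S(2) span(2) L(4) by blast
      then show ?thesis
        using mod_hom_zero[OF L(1) lP P(2)] mod_hom_zero[OF lP left_module_free_mod[OF rR] t(1)] by simp
    qed
    moreover have "f (h x) = ?v (?u x)" if x: "x \<in> carrier ?F" for x
      using g(2)[OF x, symmetric] P(4) mod_homD(1)[OF L(2) x] mod_homD(1)[OF u x] t(2) by simp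
    ultimately show ?thesis
      by (rule factors_through_freeI[OF mod_hom_comp[OF u t(1)] mod_hom_comp[OF q(1) P(3)]])
  qed
  then show ?thesis using submodule_zero[OF M] unfolding phantom_kernel_def by blast
qed

text \<open>
  Conversely, if \<open>L\<close> is presented by \<open>R\<^sup>n\<close> and \<open>S\<close>, the first factor of \<open>R\<^sup>n \<rightarrow> R\<^sup>l \<rightarrow> N\<close> kills \<open>S\<close> and
  therefore descends to \<open>L\<close>.
\<close>
lemma phantomI:
  fixes M :: "('r, 'm, 'x) module_scheme" and N :: "('r, 'n, 'y) module_scheme"
  assumes M: "left_module R M" and N: "left_module R N" and f: "f \<in> mod_hom R M N"
    and triv: "\<And>n S h. \<lbrakk>finite S; S \<subseteq> carrier (free_mod R n); h \<in> mod_hom R (free_mod R n) M;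
        \<And>s. s \<in> S \<Longrightarrow> h s = \<zero>\<^bsub>M\<^esub>\<rbrakk> \<Longrightarrow> factors_through_free R n S N (\<lambda>x. f (h x))"
  shows "phantom R M N f"
  unfolding phantom_def
proof (intro conjI M N f allI impI)
  fix L :: "('r, 'r fp_carrier) module" and g
  assume asm: "fin_presented R L \<and> g \<in> mod_hom R L M"
  then have L: "left_module R L" and g: "g \<in> mod_hom R L M" by (simp_all add: fin_presented_def)
  interpret M: left_module R M by fact
  have rR: "ring R" by (rule M.R.ring_axioms)
  obtain n p S where p: "p \<in> mod_hom R (free_mod R n) L" "p ` carrier (free_mod R n) = carrier L"
      "finite S" "S \<subseteq> carrier (free_mod R n)"
      "{x \<in> carrier (free_mod R n). p x = \<zero>\<^bsub>L\<^esub>} = mod_span R (free_mod R n) S"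
    using asm unfolding fin_presented_def by blast
  let ?F = "free_mod R n"
  have F: "left_module R ?F" by (rule left_module_free_mod[OF rR])
  note span = mod_span_submodule[OF F p(4)]
  have "factors_through_free R n S N (\<lambda>x. f (g (p x)))"
  proof (rule triv[OF p(3,4) mod_hom_comp[OF p(1) g]])
    fix s assume "s \<in> S"
    then have "p s = \<zero>\<^bsub>L\<^esub>" using p(5) span(2) by blast
    then show "g (p s) = \<zero>\<^bsub>M\<^esub>" using mod_hom_zero[OF L M g] by simp
  qed
  then obtain l u v where uv: "u \<in> mod_hom R ?F (free_mod R l)" "v \<in> mod_hom R (free_mod R l) N"
      "\<forall>s\<in>S. u s = \<zero>\<^bsub>free_mod R l\<^esub>" "\<forall>x\<in>carrier ?F. f (g (p x)) = v (u x)"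
    unfolding factors_through_free_def by blast
  let ?G = "free_mod R l"
  have G: "left_module R ?G" by (rule left_module_free_mod[OF rR])
  have "mod_span R ?F S \<subseteq> {x \<in> carrier ?F. u x \<in> {\<zero>\<^bsub>?G\<^esub>}}"
    by (rule span(3)[OF submodule_vimage[OF F G uv(1) submodule_zero[OF G]]]) (use uv(3) p(4) in auto)
  then have ker: "\<And>x. x \<in> carrier ?F \<Longrightarrow> p x = \<zero>\<^bsub>L\<^esub> \<Longrightarrow> u x = \<zero>\<^bsub>?G\<^esub>" using p(5) by blast
  obtain u' where u': "u' \<in> mod_hom R L ?G" "\<And>x. x \<in> carrier ?F \<Longrightarrow> u' (p x) = u x"
    by (rule mod_hom_factor_surj[OF F L G p(1,2) uv(1) ker]) (use that in auto)
  have fG: "fp_projective R ?G" by (rule fp_projective_free_mod[OF rR])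
  then have "fin_presented R ?G" by (rule fp_projective_fp)
  then obtain P :: "('r, 'r fp_carrier) module" and \<tau> \<sigma> where P: "fin_presented R P"
      "\<tau> \<in> mod_hom R ?G P" "\<sigma> \<in> mod_hom R P ?G"
      "\<And>x. x \<in> carrier ?G \<Longrightarrow> \<sigma> (\<tau> x) = x" "\<And>y. y \<in> carrier P \<Longrightarrow> \<tau> (\<sigma> y) = y"
    by (rule fin_presented_copy) (rule that)
  have "fp_projective R P"
    unfolding fp_projective_def
  proof (intro conjI P(1) allI impI)
    fix A B :: "('r, 'r fp_carrier) module" and e k
    assume *: "left_module R A \<and> left_module R B \<and> e \<in> mod_hom R A B \<and> e ` carrier A = carrier B \<and>
      k \<in> mod_hom R P B"
    then have AB: "left_module R A" "left_module R B" "e \<in> mod_hom R A B" "e ` carrier A = carrier B"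
      and k: "k \<in> mod_hom R P B" by simp_all
    obtain h where h: "h \<in> mod_hom R ?G A" "\<forall>x\<in>carrier ?G. e (h x) = k (\<tau> x)"
      using free_mod_lift[OF AB mod_hom_comp[OF P(2) k]] by blast
    show "\<exists>h\<in>mod_hom R P A. \<forall>x\<in>carrier P. e (h x) = k x"
      by (rule bexI[OF _ mod_hom_comp[OF P(3) h(1)]]) (simp add: h(2) P(5) mod_homD(1)[OF P(3)])
  qed
  moreover have "f (g x) = v (\<sigma> (\<tau> (u' x)))" if "x \<in> carrier L" for x
  proof -
    have "x \<in> p ` carrier ?F" using that p(2) by simp
    then obtain y where y: "y \<in> carrier ?F" "x = p y" by blast
    then show ?thesis using uv(4) u'(2) P(4)[OF mod_homD(1)[OF uv(1) y(1)]] by simp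
  qed
  ultimately show "\<exists>(P :: ('r, 'r fp_carrier) module) u v. fp_projective R P \<and> u \<in> mod_hom R L P \<and>
      v \<in> mod_hom R P N \<and> (\<forall>x\<in>carrier L. f (g x) = v (u x))"
    using mod_hom_comp[OF u'(1) P(2)] mod_hom_comp[OF P(3) uv(2)]
    by (intro exI[of _ P] exI[of _ "\<lambda>x. \<tau> (u' x)"] exI[of _ "\<lambda>x. v (\<sigma> x)"] conjI ballI)
qed

lemma phantom_relations:
  assumes "phantom R M N f" "finite S" "S \<subseteq> carrier (free_mod R n)" "h \<in> mod_hom R (free_mod R n) M"
    and "\<And>s. s \<in> S \<Longrightarrow> h s = \<zero>\<^bsub>M\<^esub>"
  shows "factors_through_free R n S N (\<lambda>x. f (h x))"
  using phantom_kernelD(2)[OF phantom_imp_phantom_kernel_zero[OF assms(1)] assms(2-4)] assms(5) by simp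

lemma phantomD:
  assumes "phantom R M N f"
  shows "left_module R M" "left_module R N" "f \<in> mod_hom R M N" "ring R"
  using assms by (simp_all add: phantom_def left_module_def)

lemma phantom_comp:
  assumes "left_module R L" "g \<in> mod_hom R L M" "phantom R M N f"
  shows "phantom R L N (\<lambda>x. f (g x))"
proof (rule phantomI[OF assms(1) phantomD(2)[OF assms(3)] mod_hom_comp[OF assms(2) phantomD(3)[OF assms(3)]]])
  fix n S h
  assume S: "finite S" "S \<subseteq> carrier (free_mod R n)" and h: "h \<in> mod_hom R (free_mod R n) L"
    "\<And>s. s \<in> S \<Longrightarrow> h s = \<zero>\<^bsub>L\<^esub>"
  show "factors_through_free R n S N (\<lambda>x. f (g (h x)))"
    by (rule phantom_relations[OF assms(3) S mod_hom_comp[OF h(1) assms(2)]])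
      (use h(2) mod_hom_zero[OF assms(1) phantomD(1)[OF assms(3)] assms(2)] in simp)
qed

text \<open>
  The factorisation is the given one, \<open>R\<^sup>m \<rightarrow> R\<^sup>n \<rightarrow> N\<close>.
\<close>
lemma phantom_free_mod:
  assumes "left_module R N" "f \<in> mod_hom R (free_mod R n) N"
  shows "phantom R (free_mod R n) N f"
proof -
  have "ring R" using assms(1) by (simp add: left_module_def)
  show ?thesis
  proof (rule phantomI[OF left_module_free_mod[OF \<open>ring R\<close>] assms])
    fix m S h
    assume "h \<in> mod_hom R (free_mod R m) (free_mod R n)" "\<And>s. s \<in> S \<Longrightarrow> h s = \<zero>\<^bsub>free_mod R n\<^esub>"
    then show "factors_through_free R m S N (\<lambda>x. f (h x))"
      by (rule factors_through_freeI[OF _ assms(2)]) auto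
  qed
qed


section \<open>Rigid phantoms\<close>

definition rigid_phantom ::
    "('r, 'z) ring_scheme \<Rightarrow> ('r, 'm, 'x) module_scheme \<Rightarrow> ('r, 'n, 'y) module_scheme \<Rightarrow> ('m \<Rightarrow> 'n) \<Rightarrow> bool"
  where "rigid_phantom R M N f \<longleftrightarrow>
    phantom R M N f \<and> (\<forall>T. phantom_kernel R M N f T \<longrightarrow> T = {\<zero>\<^bsub>M\<^esub>})"

lemma rigid_phantom_imp_phantom: "rigid_phantom R M N f \<Longrightarrow> phantom R M N f"
  by (simp add: rigid_phantom_def)

text \<open>
  In terms of quotients: \<open>M / q\<^sup>-\<^sup>1 T\<close> embeds into \<open>Q / T\<close> over \<open>N\<close>, and restrictions of phantoms are phantom.
  This single fact is used for kernels, for quotients, for isomorphic copies and for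
  submodules.
\<close>
lemma phantom_kernel_vimage:
  assumes "left_module R M" "left_module R Q" "q \<in> mod_hom R M Q" "phantom_kernel R Q N g T"
    and over: "\<And>x. x \<in> carrier M \<Longrightarrow> g (q x) = f x"
  shows "phantom_kernel R M N f {x \<in> carrier M. q x \<in> T}"
  unfolding phantom_kernel_def
proof (intro conjI allI impI)
  show "submodule {x \<in> carrier M. q x \<in> T} R M"
    by (rule submodule_vimage[OF assms(1-3) phantom_kernelD(1)[OF assms(4)]])
next
  fix n S h
  assume *: "finite S \<and> S \<subseteq> carrier (free_mod R n) \<and> h \<in> mod_hom R (free_mod R n) M \<and>
    h ` S \<subseteq> {x \<in> carrier M. q x \<in> T}"
  then have h: "h \<in> mod_hom R (free_mod R n) M" by simp
  have "factors_through_free R n S N (\<lambda>x. g (q (h x)))"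
    by (rule phantom_kernelD(2)[OF assms(4) _ _ mod_hom_comp[OF h assms(3)]]) (use * in auto)
  then show "factors_through_free R n S N (\<lambda>x. f (h x))"
    by (rule factors_through_free_cong) (use over mod_homD(1)[OF h] in simp)
qed

text \<open>
  Consider \<open>R \<rightarrow> M\<close>, \<open>1 \<mapsto> t\<close>, together with the relation \<open>1 \<mapsto> 0\<close>, which holds modulo \<open>T\<close>.
\<close>
lemma phantom_kernel_vanishes:
  assumes "left_module R M" "left_module R N" "phantom_kernel R M N f T" "t \<in> T"
  shows "f t = \<zero>\<^bsub>N\<^esub>"
proof -
  interpret M: left_module R M by fact
  have t: "t \<in> carrier M" by (rule submoduleD(1)[OF phantom_kernelD(1)[OF assms(3)] assms(4)])
  let ?e = "unit_vector R 1 0"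
  have e: "?e \<in> carrier (free_mod R 1)" by (rule unit_vector_closed[OF M.R.ring_axioms])
  have e0: "?e 0 \<odot>\<^bsub>M\<^esub> t = t" using t by (simp add: unit_vector_def)
  have "(\<lambda>x. x 0 \<odot>\<^bsub>M\<^esub> t) \<in> mod_hom R (free_mod R 1) M"
    using t by (intro mod_homI) (auto simp: free_mod_def PiE_iff M.smult_l_distr M.smult_assoc1)
  then have "factors_through_free R 1 {?e} N (\<lambda>x. f (x 0 \<odot>\<^bsub>M\<^esub> t))"
    using phantom_kernelD(2)[OF assms(3), of "{?e}" 1 "\<lambda>x. x 0 \<odot>\<^bsub>M\<^esub> t"] e e0 assms(4) by simp
  then have "f (?e 0 \<odot>\<^bsub>M\<^esub> t) = \<zero>\<^bsub>N\<^esub>"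
    by (rule factors_through_free_relation[OF M.R.ring_axioms assms(2)]) (use e in auto)
  then show ?thesis by (simp only: e0)
qed

lemma mod_hom_inj_on:
  assumes "left_module R M" "left_module R N" "h \<in> mod_hom R M N"
    and ker: "\<And>x. x \<in> carrier M \<Longrightarrow> h x = \<zero>\<^bsub>N\<^esub> \<Longrightarrow> x = \<zero>\<^bsub>M\<^esub>"
  shows "inj_on h (carrier M)"
proof (rule inj_onI)
  interpret M: left_module R M by fact
  interpret N: left_module R N by fact
  fix x y assume xy: "x \<in> carrier M" "y \<in> carrier M" "h x = h y"
  have "h (x \<oplus>\<^bsub>M\<^esub> \<ominus>\<^bsub>M\<^esub> y) = \<zero>\<^bsub>N\<^esub>"
    using xy mod_homD[OF assms(3)] mod_hom_uminus[OF assms(1-3)] by (simp add: N.M.r_neg)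
  then have "x \<oplus>\<^bsub>M\<^esub> \<ominus>\<^bsub>M\<^esub> y = \<zero>\<^bsub>M\<^esub>" using ker xy by simp
  then show "x = y" using xy by (metis M.M.add.inv_closed M.M.minus_equality M.M.minus_minus)
qed

lemma rigid_phantom_inj_on:
  assumes "rigid_phantom R X N f" "phantom R Y N g" "k \<in> mod_hom R X Y"
    and "\<And>x. x \<in> carrier X \<Longrightarrow> g (k x) = f x"
  shows "inj_on k (carrier X)"
proof -
  have X: "left_module R X" by (rule phantomD(1)[OF rigid_phantom_imp_phantom[OF assms(1)]])
  have Y: "left_module R Y" by (rule phantomD(1)[OF assms(2)])
  have "phantom_kernel R X N f {x \<in> carrier X. k x \<in> {\<zero>\<^bsub>Y\<^esub>}}"
    by (rule phantom_kernel_vimage[OF X Y assms(3) phantom_imp_phantom_kernel_zero[OF assms(2)] assms(4)])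
  then have "{x \<in> carrier X. k x \<in> {\<zero>\<^bsub>Y\<^esub>}} = {\<zero>\<^bsub>X\<^esub>}" using assms(1) by (simp add: rigid_phantom_def)
  then show ?thesis by (intro mod_hom_inj_on[OF X Y assms(3)]) blast
qed

lemma maximal_phantom_kernel:
  assumes "phantom R M N f"
  obtains T where "phantom_kernel R M N f T" "\<And>T'. phantom_kernel R M N f T' \<Longrightarrow> T \<subseteq> T' \<Longrightarrow> T' = T"
proof -
  interpret M: left_module R M by (rule phantomD(1)[OF assms])
  have "\<exists>T \<in> Collect (phantom_kernel R M N f). \<forall>T' \<in> Collect (phantom_kernel R M N f). T \<subseteq> T' \<longrightarrow> T' = T"
  proof (rule subset_Zorn)
    fix C assume C: "subset.chain (Collect (phantom_kernel R M N f)) C"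
    show "\<exists>U\<in>Collect (phantom_kernel R M N f). \<forall>T\<in>C. T \<subseteq> U"
    proof (cases "C = {}")
      case True
      then show ?thesis using phantom_imp_phantom_kernel_zero[OF assms] by blast
    next
      case False
      have pk: "phantom_kernel R M N f T" if "T \<in> C" for T
        using C that by (auto simp: subset_chain_def)
      note sub = submoduleD[OF phantom_kernelD(1)[OF pk]]
      have lin: "A \<subseteq> B \<or> B \<subseteq> A" if "A \<in> C" "B \<in> C" for A B
        using C that by (auto simp: subset_chain_def)
      have "submodule (\<Union>C) R M"
      proof (rule M.submodule_if_closed)
        fix x y assume "x \<in> \<Union>C" "y \<in> \<Union>C"
        then obtain A B where "A \<in> C" "B \<in> C" "x \<in> A" "y \<in> B" by blast
        then obtain D where "D \<in> C" "x \<in> D" "y \<in> D" using lin[of A B] by blast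
        then show "x \<oplus>\<^bsub>M\<^esub> y \<in> \<Union>C" using sub(3)[of D x y] by blast
      next
        show "\<Union>C \<subseteq> carrier M" using sub(1) by auto
        show "\<zero>\<^bsub>M\<^esub> \<in> \<Union>C" using False sub(2) by auto
        fix a x assume "a \<in> carrier R" "x \<in> \<Union>C"
        then show "a \<odot>\<^bsub>M\<^esub> x \<in> \<Union>C" using sub(4) by auto
      qed
      moreover have "factors_through_free R n S N (\<lambda>x. f (h x))"
        if h: "finite S" "S \<subseteq> carrier (free_mod R n)" "h \<in> mod_hom R (free_mod R n) M" "h ` S \<subseteq> \<Union>C"
        for n S h
      proof -
        obtain T where "T \<in> C" "h ` S \<subseteq> T"
          by (rule finite_subset_Union_chain[OF finite_imageI[OF h(1)] h(4) False C])
        then show ?thesis using phantom_kernelD(2)[OF pk h(1-3)] by blast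
      qed
      ultimately have "phantom_kernel R M N f (\<Union>C)"
        unfolding phantom_kernel_def by (intro conjI allI impI; (elim conjE)?)
      then show ?thesis by (intro bexI[of _ "\<Union>C"]) auto
    qed
  qed
  then obtain T where "T \<in> Collect (phantom_kernel R M N f)"
      "\<forall>T'\<in>Collect (phantom_kernel R M N f). T \<subseteq> T' \<longrightarrow> T' = T" by blast
  then show thesis by (intro that[of T]) simp_all
qed

text \<open>
  Dividing by a maximal \<open>T\<close> leaves nothing more to divide by, since the preimage in \<open>M\<close> of a further
  submodule would be larger than \<open>T\<close>.
\<close>
lemma rigid_quotient:
  fixes M :: "('r, 'm, 'x) module_scheme"
  assumes "phantom R M N f"
  obtains Q :: "('r, 'm set) module" and g q
  where "rigid_phantom R Q N g" "q \<in> mod_hom R M Q" "\<And>x. x \<in> carrier M \<Longrightarrow> g (q x) = f x"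
proof -
  note M = phantomD(1)[OF assms] and N = phantomD(2)[OF assms] and f = phantomD(3)[OF assms]
  interpret M: left_module R M by (rule M)
  obtain T where T: "phantom_kernel R M N f T"
      "\<And>T'. phantom_kernel R M N f T' \<Longrightarrow> T \<subseteq> T' \<Longrightarrow> T' = T"
    by (rule maximal_phantom_kernel[OF assms]) (rule that)
  obtain Q :: "('r, 'm set) module" and q where Q: "left_module R Q" "q \<in> mod_hom R M Q"
      "q ` carrier M = carrier Q" "\<And>x. x \<in> carrier M \<Longrightarrow> q x = \<zero>\<^bsub>Q\<^esub> \<longleftrightarrow> x \<in> T"
    by (rule quotient_module[OF M phantom_kernelD(1)[OF T(1)]]) (rule that)
  obtain g where g: "g \<in> mod_hom R Q N" "\<And>x. x \<in> carrier M \<Longrightarrow> g (q x) = f x"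
    by (rule mod_hom_factor_surj[OF M Q(1) N Q(2,3) f])
      (use Q(4) phantom_kernel_vanishes[OF M N T(1)] that in auto)
  have "phantom R Q N g"
  proof (rule phantomI[OF Q(1) N g(1)])
    fix n S h
    assume S: "finite S" "S \<subseteq> carrier (free_mod R n)" and h: "h \<in> mod_hom R (free_mod R n) Q"
      "\<And>s. s \<in> S \<Longrightarrow> h s = \<zero>\<^bsub>Q\<^esub>"
    obtain h' where h': "h' \<in> mod_hom R (free_mod R n) M" "\<forall>x\<in>carrier (free_mod R n). q (h' x) = h x"
      using free_mod_lift[OF M Q(1-3) h(1)] by blast
    have "factors_through_free R n S N (\<lambda>x. f (h' x))"
    proof (rule phantom_kernelD(2)[OF T(1) S h'(1)])
      fix s assume s: "s \<in> S"
      then have "s \<in> carrier (free_mod R n)" using S(2) by blast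
      moreover from this have "q (h' s) = \<zero>\<^bsub>Q\<^esub>" using h(2)[OF s] h'(2) by simp
      ultimately show "h' s \<in> T" using Q(4)[OF mod_homD(1)[OF h'(1)]] by blast
    qed
    then show "factors_through_free R n S N (\<lambda>x. g (h x))"
      by (rule factors_through_free_cong) (use g(2) mod_homD(1)[OF h'(1)] h'(2) in metis)
  qed
  moreover have "T' = {\<zero>\<^bsub>Q\<^esub>}" if T': "phantom_kernel R Q N g T'" for T'
  proof -
    note T'D = submoduleD[OF phantom_kernelD(1)[OF T']]
    have "{x \<in> carrier M. q x \<in> T'} = T"
    proof (rule T(2))
      show "phantom_kernel R M N f {x \<in> carrier M. q x \<in> T'}"
        by (rule phantom_kernel_vimage[OF M Q(1,2) T' g(2)])
      show "T \<subseteq> {x \<in> carrier M. q x \<in> T'}"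
      proof
        fix x assume "x \<in> T"
        moreover from this have "x \<in> carrier M" by (rule submoduleD(1)[OF phantom_kernelD(1)[OF T(1)]])
        ultimately show "x \<in> {x \<in> carrier M. q x \<in> T'}" using Q(4)[of x] T'D(2) by simp
      qed
    qed
    moreover have "\<exists>x\<in>carrier M. q x = y" if "y \<in> T'" for y
      using T'D(1)[OF that] unfolding Q(3)[symmetric] by auto
    ultimately have "y = \<zero>\<^bsub>Q\<^esub>" if "y \<in> T'" for y
      using Q(4) that by auto
    then show ?thesis using T'D(2) by blast
  qed
  ultimately have "rigid_phantom R Q N g" by (simp add: rigid_phantom_def)
  then show thesis using Q(2) g(2) by (rule that)
qed

lemma rigid_phantom_copy:
  fixes X :: "('r, 'm, 'x) module_scheme" and \<tau> :: "'m \<Rightarrow> 'c"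
  assumes "rigid_phantom R X N f" "inj_on \<tau> (carrier X)"
  obtains X' :: "('r, 'c) module" and \<sigma>
  where "rigid_phantom R X' N (\<lambda>y. f (\<sigma> y))" "carrier X' = \<tau> ` carrier X"
    "\<tau> \<in> mod_hom R X X'" "\<sigma> \<in> mod_hom R X' X"
    "\<And>x. x \<in> carrier X \<Longrightarrow> \<sigma> (\<tau> x) = x" "\<And>y. y \<in> carrier X' \<Longrightarrow> \<tau> (\<sigma> y) = y"
proof -
  note ph = rigid_phantom_imp_phantom[OF assms(1)]
  note X = phantomD(1)[OF ph]
  show thesis
  proof (rule left_module_copy[OF X assms(2)])
    fix X' :: "('r, 'c) module" and \<sigma>
    assume X': "left_module R X'" "carrier X' = \<tau> ` carrier X" "\<tau> \<in> mod_hom R X X'"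
      "\<sigma> \<in> mod_hom R X' X" "\<And>x. x \<in> carrier X \<Longrightarrow> \<sigma> (\<tau> x) = x"
      "\<And>y. y \<in> carrier X' \<Longrightarrow> \<tau> (\<sigma> y) = y"
    have "T = {\<zero>\<^bsub>X'\<^esub>}" if T: "phantom_kernel R X' N (\<lambda>y. f (\<sigma> y)) T" for T
    proof -
      note TD = submoduleD[OF phantom_kernelD(1)[OF T]]
      have "phantom_kernel R X N f {x \<in> carrier X. \<tau> x \<in> T}"
        by (rule phantom_kernel_vimage[OF X X'(1,3) T]) (simp add: X'(5))
      then have *: "{x \<in> carrier X. \<tau> x \<in> T} = {\<zero>\<^bsub>X\<^esub>}" using assms(1) by (simp add: rigid_phantom_def)
      have "t = \<zero>\<^bsub>X'\<^esub>" if t: "t \<in> T" for t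
      proof -
        have "\<sigma> t \<in> {x \<in> carrier X. \<tau> x \<in> T}" using t TD(1) X'(6) mod_homD(1)[OF X'(4)] by simp
        then have "\<tau> (\<sigma> t) = \<tau> \<zero>\<^bsub>X\<^esub>" using * by simp
        then show ?thesis using X'(6) TD(1)[OF t] mod_hom_zero[OF X X'(1,3)] by simp
      qed
      then show ?thesis using TD(2) by blast
    qed
    then have "rigid_phantom R X' N (\<lambda>y. f (\<sigma> y))"
      using phantom_comp[OF X'(1,4) ph] by (simp add: rigid_phantom_def)
    then show thesis by (rule that) (use X' in simp_all)
  qed
qed

section \<open>The size of a rigid phantom\<close>

text \<open>
  A pair of lists is written as one list by prefixing the length of the first component as an element
  of \<open>nat\<close>; iterating this flattens lists of lists.
\<close>
lemma list_list_prod_inj: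
  "\<exists>e :: ('r + 'n + nat) list list \<times> ('r + 'n + nat) list list \<Rightarrow> ('r + 'n + nat) list. inj e"
proof -
  define p :: "('r + 'n + nat) list \<Rightarrow> ('r + 'n + nat) list \<Rightarrow> ('r + 'n + nat) list"
    where "p xs ys = Inr (Inr (length xs)) # xs @ ys" for xs ys
  have p: "p xs ys = p xs' ys' \<longleftrightarrow> xs = xs' \<and> ys = ys'" for xs ys xs' ys' by (auto simp: p_def)
  define e where "e xss = foldr p xss []" for xss
  have e: "e xss = e yss \<Longrightarrow> xss = yss" for xss yss
  proof (induction xss arbitrary: yss)
    case Nil
    then show ?case by (cases yss) (auto simp: e_def p_def)
  next
    case (Cons x xss)
    then show ?case by (cases yss) (auto simp: e_def p, auto simp: p_def)
  qed
  have "inj (\<lambda>(xss, yss). p (e xss) (e yss))" by (auto simp: inj_def p dest: e)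
  then show ?thesis by blast
qed

text \<open>
  The reason why \<open>R t\<close> cannot be divided out: vectors \<open>ss\<close> and a map \<open>h : R\<^sup>n \<rightarrow> X\<close> sending them to
  multiples of \<open>t\<close>, such that the relations \<open>ss\<close> are not trivialised by \<open>f \<circ> h\<close>.
\<close>
lemma rigid_phantom_witness:
  assumes "rigid_phantom R X N f" "t \<in> carrier X" "t \<noteq> \<zero>\<^bsub>X\<^esub>"
  shows "\<exists>n ss cs h. set ss \<subseteq> carrier (free_mod R n) \<and> h \<in> mod_hom R (free_mod R n) X \<and>
    length cs = length ss \<and> set cs \<subseteq> carrier R \<and> (\<forall>i<length ss. h (ss ! i) = cs ! i \<odot>\<^bsub>X\<^esub> t) \<and>
    \<not> factors_through_free R n (set ss) N (\<lambda>x. f (h x))"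
proof -
  note X = phantomD(1)[OF rigid_phantom_imp_phantom[OF assms(1)]]
  interpret X: left_module R X by (rule X)
  let ?T = "{a \<odot>\<^bsub>X\<^esub> t |a. a \<in> carrier R}"
  have "t = \<one>\<^bsub>R\<^esub> \<odot>\<^bsub>X\<^esub> t" using assms(2) by simp
  then have "t \<in> ?T" using X.R.one_closed by blast
  then have "?T \<noteq> {\<zero>\<^bsub>X\<^esub>}" using assms(3) by blast
  then have "\<not> phantom_kernel R X N f ?T" using assms(1) by (auto simp: rigid_phantom_def)
  then obtain n S h where S: "finite S" "S \<subseteq> carrier (free_mod R n)" and
      h: "h \<in> mod_hom R (free_mod R n) X" "h ` S \<subseteq> ?T"
      "\<not> factors_through_free R n S N (\<lambda>x. f (h x))"
    using submodule_cyclic[OF X assms(2)] unfolding phantom_kernel_def by blast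
  obtain ss where ss: "set ss = S" using finite_list[OF S(1)] by blast
  have "\<forall>s\<in>S. \<exists>a. a \<in> carrier R \<and> h s = a \<odot>\<^bsub>X\<^esub> t" using h(2) by blast
  then obtain c where c: "\<forall>s\<in>S. c s \<in> carrier R \<and> h s = c s \<odot>\<^bsub>X\<^esub> t" by metis
  show ?thesis
    by (rule exI[of _ n], rule exI[of _ ss], rule exI[of _ "map c ss"], rule exI[of _ h])
      (use S h c ss in auto)
qed

text \<open>
  The colour of \<open>t\<close> consists of everything in a witness except \<open>h\<close> itself: the vectors, their coefficients
  at \<open>t\<close>, and the values of \<open>f \<circ> h\<close> on the unit vectors.  If \<open>t\<^sub>1\<close>, \<open>t\<^sub>2\<close> and \<open>t\<^sub>3 = t\<^sub>1 + t\<^sub>2\<close> had the same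
  colour, then \<open>k = h\<^sub>1 + h\<^sub>2 - h\<^sub>3\<close> would kill the vectors, because the coefficients agree, while
  \<open>f \<circ> k\<close> would equal the common value of the \<open>f \<circ> h\<^sub>i\<close>.  As \<open>f\<close> is phantom, it
  would trivialise the relations after all.
\<close>
lemma rigid_phantom_embedding:
  fixes R :: "('r, 'z) ring_scheme" and X :: "('r, 'm, 'x) module_scheme" and N :: "('r, 'n, 'y) module_scheme"
  assumes "rigid_phantom R X N f"
  shows "\<exists>\<iota> :: 'm \<Rightarrow> ('r + 'n + nat) list set. inj_on \<iota> (carrier X)"
proof -
  note ph = rigid_phantom_imp_phantom[OF assms]
  note X = phantomD(1)[OF ph] and N = phantomD(2)[OF ph] and f = phantomD(3)[OF ph]
  interpret X: left_module R X by (rule X)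
  interpret N: left_module R N by (rule N)
  have "\<forall>t. \<exists>n ss cs h. t \<in> carrier X \<and> t \<noteq> \<zero>\<^bsub>X\<^esub> \<longrightarrow>
      set ss \<subseteq> carrier (free_mod R n) \<and> h \<in> mod_hom R (free_mod R n) X \<and>
      length cs = length ss \<and> set cs \<subseteq> carrier R \<and> (\<forall>i<length ss. h (ss ! i) = cs ! i \<odot>\<^bsub>X\<^esub> t) \<and>
      \<not> factors_through_free R n (set ss) N (\<lambda>x. f (h x))"
    using rigid_phantom_witness[OF assms] by blast
  then obtain n ss cs h where wit: "\<forall>t. t \<in> carrier X \<and> t \<noteq> \<zero>\<^bsub>X\<^esub> \<longrightarrow>
      set (ss t) \<subseteq> carrier (free_mod R (n t)) \<and> h t \<in> mod_hom R (free_mod R (n t)) X \<and>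
      length (cs t) = length (ss t) \<and> set (cs t) \<subseteq> carrier R \<and>
      (\<forall>i<length (ss t). h t (ss t ! i) = cs t ! i \<odot>\<^bsub>X\<^esub> t) \<and>
      \<not> factors_through_free R (n t) (set (ss t)) N (\<lambda>x. f (h t x))"
    by metis
  define colour :: "'m \<Rightarrow> ('r + 'n + nat) list list" where "colour t =
      [[Inr (Inr (n t))], map Inl (cs t), map (\<lambda>i. Inr (Inl (f (h t (unit_vector R (n t) i))))) [0..<n t]]
      @ map (\<lambda>s. map (\<lambda>i. Inl (s i)) [0..<n t]) (ss t)" for t
  \<comment> \<open>The colour determines \<open>f \<circ> h\<close>, as \<open>R\<^sup>n\<close> is generated by the unit vectors.\<close>
  have colour_eq: "n t = n t' \<and> cs t = cs t' \<and> ss t = ss t' \<and>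
      (\<forall>x\<in>carrier (free_mod R (n t)). f (h t x) = f (h t' x))"
    if t: "t \<in> carrier X" "t \<noteq> \<zero>\<^bsub>X\<^esub>" and t': "t' \<in> carrier X" "t' \<noteq> \<zero>\<^bsub>X\<^esub>"
      and eq: "colour t = colour t'" for t t'
  proof -
    note w = wit[rule_format, OF conjI[OF t]] and w' = wit[rule_format, OF conjI[OF t']]
    have n: "n t = n t'" using eq by (simp add: colour_def)
    have cs: "cs t = cs t'" using eq inj_map_eq_map[of "Inl :: 'r \<Rightarrow> 'r + 'n + nat"]
      by (simp add: colour_def)
    have "f (h t (unit_vector R (n t) i)) = f (h t' (unit_vector R (n t) i))" if "i < n t" for i
      using eq that n by (simp add: colour_def)
    moreover have "(\<lambda>x. f (h t x)) \<in> mod_hom R (free_mod R (n t)) N" using w f by (auto intro: mod_hom_comp)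
    moreover have "(\<lambda>x. f (h t' x)) \<in> mod_hom R (free_mod R (n t)) N" using w' f n by (auto intro: mod_hom_comp)
    ultimately have fh: "f (h t x) = f (h t' x)" if "x \<in> carrier (free_mod R (n t))" for x
      using free_mod_hom_eqI[OF N, of "\<lambda>x. f (h t x)" "n t" "\<lambda>x. f (h t' x)" x] that by blast
    have m: "map (\<lambda>s. map (\<lambda>i. Inl (s i) :: 'r + 'n + nat) [0..<n t]) (ss t) =
        map (\<lambda>s. map (\<lambda>i. Inl (s i)) [0..<n t]) (ss t')"
      using eq n by (simp add: colour_def)
    have "ss t = ss t'"
    proof (rule nth_equalityI)
      show len: "length (ss t) = length (ss t')" using m by (rule map_eq_imp_length_eq)
      fix i assume i: "i < length (ss t)"
      have "map (\<lambda>j. Inl ((ss t ! i) j) :: 'r + 'n + nat) [0..<n t] = map (\<lambda>j. Inl ((ss t' ! i) j)) [0..<n t]"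
        using arg_cong[OF m, of "\<lambda>l. l ! i"] i len by simp
      then have *: "\<forall>j<n t. (ss t ! i) j = (ss t' ! i) j" by (simp add: map_eq_conv)
      have "ss t ! i \<in> carrier (free_mod R (n t))" "ss t' ! i \<in> carrier (free_mod R (n t))"
        using w w' n i len nth_mem by (metis subsetD)+
      then have "ss t ! i \<in> extensional {..<n t}" "ss t' ! i \<in> extensional {..<n t}"
        by (simp_all add: free_mod_def PiE_iff)
      then show "ss t ! i = ss t' ! i" by (rule extensionalityI) (use * in simp)
    qed
    then show ?thesis using n cs fh by blast
  qed
  \<comment> \<open>Pairs from different fibres of \<open>f\<close> are coloured by the values of \<open>f\<close>, which excludes triangles by itself; the length of the list separates these colours from the others.\<close>
  define c where "c u v = (if f u = f v then colour (u \<oplus>\<^bsub>X\<^esub> \<ominus>\<^bsub>X\<^esub> v)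
    else [[Inr (Inl (f u)), Inr (Inl (f v))]])" for u v
  have long: "colour t \<noteq> [[x, y]]" for t x y by (simp add: colour_def)
  have "\<exists>\<iota> :: 'm \<Rightarrow> (('r + 'n + nat) list list \<times> ('r + 'n + nat) list list) set. inj_on \<iota> (carrier X)"
  proof (rule triangle_free_colouring_bound[of _ c])
    fix u v w
    assume uvw: "u \<in> carrier X" "v \<in> carrier X" "w \<in> carrier X" "u \<noteq> v" "v \<noteq> w" "u \<noteq> w"
      and eq: "c u v = c u w" "c v w = c u w"
    have fib: "f u = f v" "f v = f w"
    proof -
      show "f u = f v" using eq long long[THEN not_sym] by (auto simp: c_def split: if_splits)
      then show "f v = f w" using eq long long[THEN not_sym] by (auto simp: c_def split: if_splits)
    qed
    define t1 t2 t3 where "t1 = u \<oplus>\<^bsub>X\<^esub> \<ominus>\<^bsub>X\<^esub> v" and "t2 = v \<oplus>\<^bsub>X\<^esub> \<ominus>\<^bsub>X\<^esub> w" and "t3 = u \<oplus>\<^bsub>X\<^esub> \<ominus>\<^bsub>X\<^esub> w"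
    have col: "colour t1 = colour t3" "colour t2 = colour t3"
      using eq fib by (simp_all add: c_def t1_def t2_def t3_def)
    have tc: "t1 \<in> carrier X" "t2 \<in> carrier X" "t3 \<in> carrier X"
      using uvw by (simp_all add: t1_def t2_def t3_def)
    have nz: "x \<oplus>\<^bsub>X\<^esub> \<ominus>\<^bsub>X\<^esub> y \<noteq> \<zero>\<^bsub>X\<^esub>" if "x \<in> carrier X" "y \<in> carrier X" "x \<noteq> y" for x y
      using that by (metis X.M.add.inv_closed X.M.minus_equality X.M.minus_minus)
    have tn: "t1 \<noteq> \<zero>\<^bsub>X\<^esub>" "t2 \<noteq> \<zero>\<^bsub>X\<^esub>" "t3 \<noteq> \<zero>\<^bsub>X\<^esub>"
      using uvw nz by (simp_all add: t1_def t2_def t3_def)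
    have sum: "t1 \<oplus>\<^bsub>X\<^esub> t2 = t3"
      using uvw by (simp add: t1_def t2_def t3_def X.M.a_assoc X.M.r_neg1)
    note e1 = colour_eq[OF tc(1) tn(1) tc(3) tn(3) col(1)]
      and e2 = colour_eq[OF tc(2) tn(2) tc(3) tn(3) col(2)]
    note w1 = wit[rule_format, OF conjI[OF tc(1) tn(1)]] and w2 = wit[rule_format, OF conjI[OF tc(2) tn(2)]]
      and w3 = wit[rule_format, OF conjI[OF tc(3) tn(3)]]
    have same: "n t1 = n t3" "ss t1 = ss t3" "cs t1 = cs t3" "n t2 = n t3" "ss t2 = ss t3" "cs t2 = cs t3"
      and fh: "\<And>x. x \<in> carrier (free_mod R (n t1)) \<Longrightarrow> f (h t1 x) = f (h t3 x)"
        "\<And>x. x \<in> carrier (free_mod R (n t2)) \<Longrightarrow> f (h t2 x) = f (h t3 x)"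
      using e1 e2 by simp_all
    have rel: "\<forall>i<length (ss t1). h t1 (ss t1 ! i) = cs t1 ! i \<odot>\<^bsub>X\<^esub> t1"
        "\<forall>i<length (ss t2). h t2 (ss t2 ! i) = cs t2 ! i \<odot>\<^bsub>X\<^esub> t2"
        "\<forall>i<length (ss t3). h t3 (ss t3 ! i) = cs t3 ! i \<odot>\<^bsub>X\<^esub> t3"
      and homs: "h t1 \<in> mod_hom R (free_mod R (n t1)) X" "h t2 \<in> mod_hom R (free_mod R (n t2)) X"
        "h t3 \<in> mod_hom R (free_mod R (n t3)) X"
      and R3: "set (cs t3) \<subseteq> carrier R" "length (cs t3) = length (ss t3)"
        "set (ss t3) \<subseteq> carrier (free_mod R (n t3))"
      and nf: "\<not> factors_through_free R (n t3) (set (ss t3)) N (\<lambda>x. f (h t3 x))"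
      using w1 w2 w3 by - (elim conjE, assumption)+
    let ?F = "free_mod R (n t3)"
    define k where "k x = (h t1 x \<oplus>\<^bsub>X\<^esub> h t2 x) \<oplus>\<^bsub>X\<^esub> \<ominus>\<^bsub>X\<^esub> h t3 x" for x
    have h: "h t1 \<in> mod_hom R ?F X" "h t2 \<in> mod_hom R ?F X" "h t3 \<in> mod_hom R ?F X"
      using homs same by simp_all
    have k: "k \<in> mod_hom R ?F X"
      unfolding k_def by (intro mod_hom_add mod_hom_minus X h)
    have "k s = \<zero>\<^bsub>X\<^esub>" if s: "s \<in> set (ss t3)" for s
    proof -
      obtain i where i: "i < length (ss t3)" "s = ss t3 ! i" using s unfolding in_set_conv_nth by blast
      let ?a = "cs t3 ! i"
      have a: "?a \<in> carrier R" using R3 i nth_mem[of i "cs t3"] by auto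
      have "h t1 s = ?a \<odot>\<^bsub>X\<^esub> t1" "h t2 s = ?a \<odot>\<^bsub>X\<^esub> t2" "h t3 s = ?a \<odot>\<^bsub>X\<^esub> (t1 \<oplus>\<^bsub>X\<^esub> t2)"
        using rel same i sum by simp_all
      then show ?thesis using a tc by (simp add: k_def X.smult_r_distr X.M.r_neg)
    qed
    then have "factors_through_free R (n t3) (set (ss t3)) N (\<lambda>x. f (k x))"
      using R3 by (intro phantom_relations[OF ph _ _ k]) simp_all
    moreover have "f (k x) = f (h t3 x)" if x: "x \<in> carrier ?F" for x
    proof -
      note hx = mod_homD(1)[OF h(1) x] mod_homD(1)[OF h(2) x] mod_homD(1)[OF h(3) x]
      have "f (k x) = (f (h t3 x) \<oplus>\<^bsub>N\<^esub> f (h t3 x)) \<oplus>\<^bsub>N\<^esub> \<ominus>\<^bsub>N\<^esub> f (h t3 x)"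
        using hx x fh same by (simp add: k_def mod_homD[OF f] mod_hom_uminus[OF X N f])
      then show ?thesis using mod_homD(1)[OF f hx(3)] by (simp add: N.M.a_assoc N.M.r_neg)
    qed
    ultimately have "factors_through_free R (n t3) (set (ss t3)) N (\<lambda>x. f (h t3 x))"
      by (rule factors_through_free_cong)
    then show False using nf by contradiction
  qed
  then obtain \<iota> :: "'m \<Rightarrow> (('r + 'n + nat) list list \<times> ('r + 'n + nat) list list) set"
    where \<iota>: "inj_on \<iota> (carrier X)" by blast
  obtain e :: "('r + 'n + nat) list list \<times> ('r + 'n + nat) list list \<Rightarrow> ('r + 'n + nat) list"
    where e: "inj e" using list_list_prod_inj by blast
  have "inj_on (\<lambda>x. e ` \<iota> x) (carrier X)"
    using \<iota> by (auto simp: inj_on_def inj_image_eq_iff[OF e])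
  then show ?thesis by blast
qed


section \<open>Maximal rigid phantoms\<close>

text \<open>
  Extension of phantoms inside a fixed type, for pairs of a module and a map to \<open>N\<close>.  It is only a
  preorder: operations may differ outside the carriers.
\<close>
definition phantom_extension ::
    "('r, 'z) ring_scheme \<Rightarrow> ('r, 'm) module \<times> ('m \<Rightarrow> 'n) \<Rightarrow> ('r, 'm) module \<times> ('m \<Rightarrow> 'n) \<Rightarrow> bool"
  where "phantom_extension R p q \<longleftrightarrow>
    (\<lambda>x. x) \<in> mod_hom R (fst p) (fst q) \<and> (\<forall>x\<in>carrier (fst p). snd q x = snd p x)"

lemma phantom_extensionD:
  assumes "phantom_extension R p q"
  shows "x \<in> carrier (fst p) \<Longrightarrow> x \<in> carrier (fst q)"
    and "x \<in> carrier (fst p) \<Longrightarrow> y \<in> carrier (fst p) \<Longrightarrow> x \<oplus>\<^bsub>fst q\<^esub> y = x \<oplus>\<^bsub>fst p\<^esub> y"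
    and "a \<in> carrier R \<Longrightarrow> x \<in> carrier (fst p) \<Longrightarrow> a \<odot>\<^bsub>fst q\<^esub> x = a \<odot>\<^bsub>fst p\<^esub> x"
    and "x \<in> carrier (fst p) \<Longrightarrow> snd q x = snd p x"
  using assms mod_homD[of "\<lambda>x. x" R "fst p" "fst q"] by (simp_all add: phantom_extension_def)

lemma phantom_extensionI:
  assumes "\<And>x. x \<in> carrier (fst p) \<Longrightarrow> x \<in> carrier (fst q)"
    and "\<And>x y. x \<in> carrier (fst p) \<Longrightarrow> y \<in> carrier (fst p) \<Longrightarrow> x \<oplus>\<^bsub>fst q\<^esub> y = x \<oplus>\<^bsub>fst p\<^esub> y"
    and "\<And>a x. a \<in> carrier R \<Longrightarrow> x \<in> carrier (fst p) \<Longrightarrow> a \<odot>\<^bsub>fst q\<^esub> x = a \<odot>\<^bsub>fst p\<^esub> x"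
    and "\<And>x. x \<in> carrier (fst p) \<Longrightarrow> snd q x = snd p x"
  shows "phantom_extension R p q"
  unfolding phantom_extension_def by (intro conjI mod_homI ballI) (simp_all add: assms)

lemma phantom_extension_trans:
  assumes pq: "phantom_extension R p q" and qr: "phantom_extension R q r"
  shows "phantom_extension R p r"
  by (rule phantom_extensionI)
    (simp_all add: phantom_extensionD[OF pq] phantom_extensionD[OF qr])

text \<open>
  The union \<open>U\<close> of the chain is rigid as well.  A map \<open>R\<^sup>n \<rightarrow> U\<close> takes its values in a single member of
  the chain, because the images of the unit vectors do; so \<open>U\<close> is phantom.  A phantom kernel of \<open>U\<close>
  meets each member in a phantom kernel of that member, which is zero.
\<close>
lemma chain_of_rigid_phantoms_bounded:
  fixes C :: "(('r, 'm) module \<times> ('m \<Rightarrow> 'n)) set" and N :: "('r, 'n, 'y) module_scheme"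
  assumes "C \<noteq> {}" and rig: "\<And>p. p \<in> C \<Longrightarrow> rigid_phantom R (fst p) N (snd p)"
    and lin: "\<And>p q. p \<in> C \<Longrightarrow> q \<in> C \<Longrightarrow> phantom_extension R p q \<or> phantom_extension R q p"
  shows "\<exists>u. rigid_phantom R (fst u) N (snd u) \<and> (\<forall>p\<in>C. phantom_extension R p u)"
proof -
  note ph = rigid_phantom_imp_phantom[OF rig]
  note lm = phantomD(1)[OF ph]
  obtain p0 where p0: "p0 \<in> C" using assms(1) by blast
  have N: "left_module R N" by (rule phantomD(2)[OF ph[OF p0]])
  interpret N: left_module R N by (rule N)
  define cU where "cU = (\<Union>p\<in>C. carrier (fst p))"
  have in2: "\<exists>p\<in>C. x \<in> carrier (fst p) \<and> y \<in> carrier (fst p)" if xy: "x \<in> cU" "y \<in> cU" for x y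
  proof -
    obtain p q where pq: "p \<in> C" "q \<in> C" "x \<in> carrier (fst p)" "y \<in> carrier (fst q)"
      using xy by (auto simp: cU_def)
    from lin[OF pq(1,2)] show ?thesis
    proof
      assume "phantom_extension R p q"
      from phantom_extensionD(1)[OF this pq(3)] pq show ?thesis by blast
    next
      assume "phantom_extension R q p"
      from phantom_extensionD(1)[OF this pq(4)] pq show ?thesis by blast
    qed
  qed
  have in3: "\<exists>p\<in>C. x \<in> carrier (fst p) \<and> y \<in> carrier (fst p) \<and> z \<in> carrier (fst p)"
    if xyz: "x \<in> cU" "y \<in> cU" "z \<in> cU" for x y z
  proof -
    obtain p q where pq: "p \<in> C" "q \<in> C" "x \<in> carrier (fst p)" "y \<in> carrier (fst p)" "z \<in> carrier (fst q)"
      using in2[OF xyz(1,2)] xyz(3) by (auto simp: cU_def)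
    from lin[OF pq(1,2)] show ?thesis
    proof
      assume "phantom_extension R p q"
      from phantom_extensionD(1)[OF this pq(3)] phantom_extensionD(1)[OF this pq(4)] pq show ?thesis by blast
    next
      assume "phantom_extension R q p"
      from phantom_extensionD(1)[OF this pq(5)] pq show ?thesis by blast
    qed
  qed
  \<comment> \<open>The operations of \<open>U\<close> are computed in any member containing the arguments; all choices agree.\<close>
  define pick where "pick x y = (SOME p. p \<in> C \<and> x \<in> carrier (fst p) \<and> y \<in> carrier (fst p))" for x y
  have pick: "pick x y \<in> C" "x \<in> carrier (fst (pick x y))" "y \<in> carrier (fst (pick x y))"
    if "p \<in> C" "x \<in> carrier (fst p)" "y \<in> carrier (fst p)" for p x y
    using someI[of "\<lambda>p. p \<in> C \<and> x \<in> carrier (fst p) \<and> y \<in> carrier (fst p)" p] that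
    unfolding pick_def by blast+
  define U :: "('r, 'm) module" where "U =
    \<lparr>carrier = cU, mult = undefined, one = undefined, zero = \<zero>\<^bsub>fst p0\<^esub>,
     add = (\<lambda>x y. x \<oplus>\<^bsub>fst (pick x y)\<^esub> y), smult = (\<lambda>a x. a \<odot>\<^bsub>fst (pick x x)\<^esub> x)\<rparr>"
  define g where "g x = snd (pick x x) x" for x
  have cU: "carrier U = cU" by (simp add: U_def)
  have carr: "x \<in> cU" if "p \<in> C" "x \<in> carrier (fst p)" for p x using that by (auto simp: cU_def)
  have zU: "\<zero>\<^bsub>U\<^esub> = \<zero>\<^bsub>fst p\<^esub>" if p: "p \<in> C" for p
  proof -
    have *: "\<zero>\<^bsub>fst q\<^esub> = \<zero>\<^bsub>fst p\<^esub>" if "p \<in> C" "q \<in> C" "phantom_extension R p q" for p q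
      using mod_hom_zero[OF lm[OF that(1)] lm[OF that(2)], of "\<lambda>x. x"] that(3)
      by (simp add: phantom_extension_def)
    show ?thesis using lin[OF p p0] *[OF p p0] *[OF p0 p] by (auto simp: U_def)
  qed
  have addU: "x \<oplus>\<^bsub>U\<^esub> y = x \<oplus>\<^bsub>fst p\<^esub> y" if pxy: "p \<in> C" "x \<in> carrier (fst p)" "y \<in> carrier (fst p)" for p x y
    using lin[OF pxy(1) pick(1)[OF pxy]]
  proof
    assume "phantom_extension R p (pick x y)"
    from phantom_extensionD(2)[OF this pxy(2,3)] show ?thesis by (simp add: U_def)
  next
    assume "phantom_extension R (pick x y) p"
    from phantom_extensionD(2)[OF this pick(2,3)[OF pxy]] show ?thesis by (simp add: U_def)
  qed
  have smU: "a \<odot>\<^bsub>U\<^esub> x = a \<odot>\<^bsub>fst p\<^esub> x" if px: "p \<in> C" "x \<in> carrier (fst p)" and a: "a \<in> carrier R" for p a x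
    using lin[OF px(1) pick(1)[OF px px(2)]]
  proof
    assume "phantom_extension R p (pick x x)"
    from phantom_extensionD(3)[OF this a px(2)] show ?thesis by (simp add: U_def)
  next
    assume "phantom_extension R (pick x x) p"
    from phantom_extensionD(3)[OF this a pick(2)[OF px px(2)]] show ?thesis by (simp add: U_def)
  qed
  have gU: "g x = snd p x" if px: "p \<in> C" "x \<in> carrier (fst p)" for p x
    using lin[OF px(1) pick(1)[OF px px(2)]]
  proof
    assume "phantom_extension R p (pick x x)"
    from phantom_extensionD(4)[OF this px(2)] show ?thesis by (simp add: g_def)
  next
    assume "phantom_extension R (pick x x) p"
    from phantom_extensionD(4)[OF this pick(2)[OF px px(2)]] show ?thesis by (simp add: g_def)
  qed
  have "abelian_group U"
  proof (rule abelian_groupI)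
    fix x y assume "x \<in> carrier U" "y \<in> carrier U"
    then obtain p where p: "p \<in> C" "x \<in> carrier (fst p)" "y \<in> carrier (fst p)"
      using in2 cU by blast
    interpret P: left_module R "fst p" by (rule lm[OF p(1)])
    show "x \<oplus>\<^bsub>U\<^esub> y \<in> carrier U" using p carr[OF p(1)] by (simp add: addU[OF p] cU)
    show "x \<oplus>\<^bsub>U\<^esub> y = y \<oplus>\<^bsub>U\<^esub> x" using p by (simp add: addU[OF p(1)] P.M.a_comm)
    show "\<zero>\<^bsub>U\<^esub> \<oplus>\<^bsub>U\<^esub> x = x" using p by (simp add: zU[OF p(1)] addU[OF p(1)])
    have "(\<ominus>\<^bsub>fst p\<^esub> x) \<oplus>\<^bsub>U\<^esub> x = \<zero>\<^bsub>U\<^esub>" using p by (simp add: zU[OF p(1)] addU[OF p(1)] P.M.l_neg)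
    moreover have "\<ominus>\<^bsub>fst p\<^esub> x \<in> carrier U" using p carr[OF p(1)] by (simp add: cU)
    ultimately show "\<exists>y\<in>carrier U. y \<oplus>\<^bsub>U\<^esub> x = \<zero>\<^bsub>U\<^esub>" by (rule bexI)
  next
    interpret P: left_module R "fst p0" by (rule lm[OF p0])
    show "\<zero>\<^bsub>U\<^esub> \<in> carrier U" using carr[OF p0] by (simp add: zU[OF p0] cU)
  next
    fix x y z assume "x \<in> carrier U" "y \<in> carrier U" "z \<in> carrier U"
    then obtain p where p: "p \<in> C" "x \<in> carrier (fst p)" "y \<in> carrier (fst p)" "z \<in> carrier (fst p)"
      using in3 cU by blast
    interpret P: left_module R "fst p" by (rule lm[OF p(1)])
    show "x \<oplus>\<^bsub>U\<^esub> y \<oplus>\<^bsub>U\<^esub> z = x \<oplus>\<^bsub>U\<^esub> (y \<oplus>\<^bsub>U\<^esub> z)" using p by (simp add: addU[OF p(1)] P.M.a_assoc)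
  qed
  then have U: "left_module R U"
  proof (intro left_module.intro left_module_axioms.intro N.R.ring_axioms)
    fix a b x y assume a: "a \<in> carrier R" and b: "b \<in> carrier R" and "x \<in> carrier U" "y \<in> carrier U"
    then obtain p where p: "p \<in> C" "x \<in> carrier (fst p)" "y \<in> carrier (fst p)"
      using in2 cU by blast
    interpret P: left_module R "fst p" by (rule lm[OF p(1)])
    show "a \<odot>\<^bsub>U\<^esub> (x \<oplus>\<^bsub>U\<^esub> y) = a \<odot>\<^bsub>U\<^esub> x \<oplus>\<^bsub>U\<^esub> a \<odot>\<^bsub>U\<^esub> y"
      using p a by (simp add: addU[OF p(1)] smU[OF p(1)] P.smult_r_distr)
  next
    fix a x assume a: "a \<in> carrier R" and "x \<in> carrier U"
    then obtain p where p: "p \<in> C" "x \<in> carrier (fst p)" using cU by (auto simp: cU_def)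
    interpret P: left_module R "fst p" by (rule lm[OF p(1)])
    show "a \<odot>\<^bsub>U\<^esub> x \<in> carrier U" using p a carr[OF p(1)] by (simp add: smU[OF p(1)] cU)
    fix b assume b: "b \<in> carrier R"
    show "(a \<oplus>\<^bsub>R\<^esub> b) \<odot>\<^bsub>U\<^esub> x = a \<odot>\<^bsub>U\<^esub> x \<oplus>\<^bsub>U\<^esub> b \<odot>\<^bsub>U\<^esub> x"
      using p a b by (simp add: addU[OF p(1)] smU[OF p(1)] P.smult_l_distr)
    show "(a \<otimes>\<^bsub>R\<^esub> b) \<odot>\<^bsub>U\<^esub> x = a \<odot>\<^bsub>U\<^esub> (b \<odot>\<^bsub>U\<^esub> x)"
      using p a b by (simp add: smU[OF p(1)] P.smult_assoc1)
  next
    fix x assume "x \<in> carrier U"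
    then obtain p where p: "p \<in> C" "x \<in> carrier (fst p)" using cU by (auto simp: cU_def)
    interpret P: left_module R "fst p" by (rule lm[OF p(1)])
    show "\<one>\<^bsub>R\<^esub> \<odot>\<^bsub>U\<^esub> x = x" using p by (simp add: smU[OF p(1)])
  qed
  interpret U: left_module R U by (rule U)
  have ext: "phantom_extension R p (U, g)" if p: "p \<in> C" for p
    by (rule phantom_extensionI) (simp_all add: addU[OF p] smU[OF p] gU[OF p] cU carr[OF p])
  have incl: "(\<lambda>x. x) \<in> mod_hom R (fst p) U" if "p \<in> C" for p
    using ext[OF that] by (simp add: phantom_extension_def)
  have sub: "submodule (carrier (fst p)) R U" if p: "p \<in> C" for p
  proof -
    interpret P: left_module R "fst p" by (rule lm[OF p])
    show ?thesis
      by (rule U.submodule_if_closed)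
        (use carr[OF p] in \<open>auto simp: cU zU[OF p] addU[OF p] smU[OF p]\<close>)
  qed
  have g: "g \<in> mod_hom R U N"
  proof (rule mod_homI)
    fix x y assume "x \<in> carrier U" "y \<in> carrier U"
    then obtain p where p: "p \<in> C" "x \<in> carrier (fst p)" "y \<in> carrier (fst p)"
      using in2 cU by blast
    interpret P: left_module R "fst p" by (rule lm[OF p(1)])
    note sp = mod_homD[OF phantomD(3)[OF ph[OF p(1)]]]
    show "g x \<in> carrier N" using p by (simp add: gU[OF p(1)] sp)
    show "g (x \<oplus>\<^bsub>U\<^esub> y) = g x \<oplus>\<^bsub>N\<^esub> g y" using p by (simp add: addU[OF p(1)] gU[OF p(1)] sp)
    show "g (a \<odot>\<^bsub>U\<^esub> x) = a \<odot>\<^bsub>N\<^esub> g x" if "a \<in> carrier R" for a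
      using p that by (simp add: smU[OF p(1)] gU[OF p(1)] sp)
  qed
  have "phantom R U N g"
  proof (rule phantomI[OF U N g])
    fix n S h
    assume S: "finite S" "S \<subseteq> carrier (free_mod R n)" and h: "h \<in> mod_hom R (free_mod R n) U"
      and hS: "\<And>s. s \<in> S \<Longrightarrow> h s = \<zero>\<^bsub>U\<^esub>"
    let ?F = "free_mod R n"
    have F: "left_module R ?F" by (rule left_module_free_mod[OF N.R.ring_axioms])
    have he: "h (unit_vector R n i) \<in> cU" for i
      using mod_homD(1)[OF h unit_vector_closed[OF N.R.ring_axioms]] cU by simp
    have "\<exists>p\<in>C. \<forall>i<k. h (unit_vector R n i) \<in> carrier (fst p)" for k
    proof (induction k)
      case 0
      then show ?case using p0 by blast
    next
      case (Suc k)
      then obtain p where p: "p \<in> C" "\<forall>i<k. h (unit_vector R n i) \<in> carrier (fst p)" by blast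
      obtain q where q: "q \<in> C" "h (unit_vector R n k) \<in> carrier (fst q)"
        using he[of k] by (auto simp: cU_def)
      from lin[OF p(1) q(1)] show ?case
      proof
        assume "phantom_extension R p q"
        note D = phantom_extensionD(1)[OF this]
        show ?case by (rule bexI[OF _ q(1)]) (use D p q in \<open>auto simp: less_Suc_eq\<close>)
      next
        assume "phantom_extension R q p"
        note D = phantom_extensionD(1)[OF this]
        show ?case by (rule bexI[OF _ p(1)]) (use D p q in \<open>auto simp: less_Suc_eq\<close>)
      qed
    qed
    then obtain p where p: "p \<in> C" "\<forall>i<n. h (unit_vector R n i) \<in> carrier (fst p)" by blast
    have hp: "h x \<in> carrier (fst p)" if x: "x \<in> carrier ?F" for x
      using unit_vectors_generate[OF N.R.ring_axioms submodule_vimage[OF F U h sub[OF p(1)]] _ x]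
        p(2) unit_vector_closed[OF N.R.ring_axioms, of n] by simp
    have h': "h \<in> mod_hom R ?F (fst p)"
      using mod_homD[OF h] hp
      by (intro mod_homI) (simp_all add: addU[OF p(1)] smU[OF p(1)])
    have "factors_through_free R n S N (\<lambda>x. snd p (h x))"
      by (rule phantom_relations[OF ph[OF p(1)] S h']) (simp add: hS zU[OF p(1)])
    then show "factors_through_free R n S N (\<lambda>x. g (h x))"
      by (rule factors_through_free_cong) (simp add: gU[OF p(1)] hp)
  qed
  moreover have "T = {\<zero>\<^bsub>U\<^esub>}" if T: "phantom_kernel R U N g T" for T
  proof -
    note TD = submoduleD[OF phantom_kernelD(1)[OF T]]
    have "t = \<zero>\<^bsub>U\<^esub>" if t: "t \<in> T" for t
    proof -
      have "t \<in> cU" using TD(1)[OF t] cU by simp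
      then obtain p where p: "p \<in> C" "t \<in> carrier (fst p)" by (auto simp: cU_def)
      have "phantom_kernel R (fst p) N (snd p) {x \<in> carrier (fst p). x \<in> T}"
        by (rule phantom_kernel_vimage[OF lm[OF p(1)] U incl[OF p(1)] T gU[OF p(1)]])
      then have "{x \<in> carrier (fst p). x \<in> T} = {\<zero>\<^bsub>fst p\<^esub>}"
        using rig[OF p(1)] by (simp add: rigid_phantom_def)
      then show ?thesis using t p zU[OF p(1)] by auto
    qed
    then show ?thesis using TD(2) by blast
  qed
  ultimately have "rigid_phantom R U N g" by (simp add: rigid_phantom_def)
  then show ?thesis using ext by (intro exI[of _ "(U, g)"]) simp
qed

definition maximal_rigid_phantom ::
    "('r, 'z) ring_scheme \<Rightarrow> ('r, 'm) module \<Rightarrow> ('r, 'n, 'y) module_scheme \<Rightarrow> ('m \<Rightarrow> 'n) \<Rightarrow> bool"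
  where "maximal_rigid_phantom R X N f \<longleftrightarrow> rigid_phantom R X N f \<and>
    (\<forall>Y g. rigid_phantom R Y N g \<and> phantom_extension R (X, f) (Y, g) \<longrightarrow> carrier Y \<subseteq> carrier X)"

lemma zero_rigid_phantom:
  fixes N :: "('r, 'n, 'y) module_scheme"
  assumes "left_module R N"
  shows "\<exists>(X :: ('r, 'm) module) f. rigid_phantom R X N f"
proof -
  interpret N: left_module R N by fact
  let ?F = "free_mod R 0" and ?f = "\<lambda>x. \<zero>\<^bsub>N\<^esub>"
  have F: "left_module R ?F" by (rule left_module_free_mod[OF N.R.ring_axioms])
  have c: "carrier ?F = {\<zero>\<^bsub>?F\<^esub>}" by (auto simp: free_mod_def restrict_def)
  have "T = {\<zero>\<^bsub>?F\<^esub>}" if "phantom_kernel R ?F N ?f T" for T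
    using submoduleD(1,2)[OF phantom_kernelD(1)[OF that]] c by blast
  moreover have "phantom R ?F N ?f"
    by (rule phantom_free_mod[OF assms mod_hom_const_zero[OF F assms]])
  ultimately have rigid: "rigid_phantom R ?F N ?f" by (simp add: rigid_phantom_def)
  have "inj_on (\<lambda>_. undefined :: 'm) (carrier ?F)" by (simp add: c)
  from rigid_phantom_copy[OF rigid this] show ?thesis by metis
qed

text \<open>
  For a preorder, Hausdorff's maximal principle takes the place of Zorn's lemma: an upper bound of a
  maximal chain is maximal.
\<close>
lemma maximal_rigid_phantom_exists:
  fixes N :: "('r, 'n, 'y) module_scheme"
  assumes "left_module R N"
  obtains X :: "('r, 'm) module" and f where "maximal_rigid_phantom R X N f"
proof -
  let ?A = "{p :: ('r, 'm) module \<times> ('m \<Rightarrow> 'n). rigid_phantom R (fst p) N (snd p)}"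
  let ?E = "phantom_extension R"
  obtain C where C: "pred_on.maxchain ?A ?E C" using pred_on.Hausdorff by blast
  then have chain: "C \<subseteq> ?A" "\<And>p q. p \<in> C \<Longrightarrow> q \<in> C \<Longrightarrow> p = q \<or> ?E p q \<or> ?E q p"
    by (auto simp: pred_on.maxchain_def pred_on.chain_def)
  have refl: "?E p p" for p by (rule phantom_extensionI) auto
  have "\<exists>u. u \<in> ?A \<and> (\<forall>p\<in>C. ?E p u)"
  proof (cases "C = {}")
    case True
    obtain X :: "('r, 'm) module" and f where "rigid_phantom R X N f"
      using zero_rigid_phantom[OF assms] by blast
    then show ?thesis using True by (intro exI[of _ "(X, f)"]) simp
  next
    case False
    have "\<exists>u. rigid_phantom R (fst u) N (snd u) \<and> (\<forall>p\<in>C. ?E p u)"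
      by (rule chain_of_rigid_phantoms_bounded[OF False]) (use chain refl in blast)+
    then show ?thesis by simp
  qed
  then obtain u where u: "u \<in> ?A" "\<forall>p\<in>C. ?E p u" by blast
  have "carrier Y \<subseteq> carrier (fst u)"
    if Y: "rigid_phantom R Y N g" "?E u (Y, g)" for Y :: "('r, 'm) module" and g
  proof -
    have "pred_on.chain ?A ?E (insert (Y, g) C)"
      unfolding pred_on.chain_def
    proof (intro conjI ballI)
      show "insert (Y, g) C \<subseteq> ?A" using chain(1) Y(1) by simp
      have top: "?E p (Y, g)" if "p \<in> insert (Y, g) C" for p
        using phantom_extension_trans[OF _ Y(2)] refl u(2) that by blast
      fix p q assume pq: "p \<in> insert (Y, g) C" "q \<in> insert (Y, g) C"
      then consider "p \<in> C" "q \<in> C" | "p = (Y, g)" | "q = (Y, g)" by blast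
      then show "?E\<^sup>=\<^sup>= p q \<or> ?E\<^sup>=\<^sup>= q p"
      proof cases
        case 1
        from chain(2)[OF this] show ?thesis by (elim disjE) simp_all
      next
        case 2
        then show ?thesis using top[OF pq(2)] by simp
      next
        case 3
        then show ?thesis using top[OF pq(1)] by simp
      qed
    qed
    then have "(Y, g) \<in> C"
      using C unfolding pred_on.maxchain_def by blast
    then have "?E (Y, g) u" using u(2) by blast
    then show ?thesis using phantom_extensionD(1)[of R "(Y, g)" u] by auto
  qed
  then have "maximal_rigid_phantom R (fst u) N (snd u)"
    unfolding maximal_rigid_phantom_def prod.collapse using u(1) by blast
  then show thesis by (rule that)
qed

text \<open>
  Cantor's theorem, in the form that makes room for extensions: a subset of \<open>'u \<times> 'u set\<close> no larger
  than \<open>'u\<close> leaves a free place in every row.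
\<close>
lemma fresh_second_component:
  assumes "inj_on (\<iota> :: 'u \<times> 'u set \<Rightarrow> 'u) X"
  shows "\<exists>A. (u, A) \<notin> X"
proof (rule ccontr)
  assume "\<not> ?thesis"
  then have "inj (\<lambda>A. \<iota> (u, A))" using assms(1) by (auto simp: inj_on_def)
  then have "surj (inv_into UNIV (\<lambda>A. \<iota> (u, A)))" by (rule inj_imp_surj_inv)
  then show False using Cantors_theorem[of "UNIV :: 'u set"] by auto
qed

text \<open>
  The carrier type is a product \<open>'u \<times> 'u set\<close>, where \<open>'u\<close> accommodates every rigid phantom to \<open>N\<close>.  So
  if \<open>k : X \<rightarrow> Z\<close> is not onto, then \<open>Z\<close>, which is rigid and contains \<open>X\<close> by means of \<open>k\<close>, has a copy in this
  type that contains \<open>X\<close> literally and places each further element into a free place of its own row.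
  This contradicts the maximality of \<open>X\<close>.
\<close>
lemma maximal_rigid_phantom_absorbs:
  fixes X :: "('r, ('r + 'n + nat) list set \<times> ('r + 'n + nat) list set set) module"
    and Z :: "('r, 't, 'x) module_scheme" and N :: "('r, 'n, 'y) module_scheme"
  assumes X: "maximal_rigid_phantom R X N f" and Z: "rigid_phantom R Z N g"
    and k: "k \<in> mod_hom R X Z" and over: "\<And>x. x \<in> carrier X \<Longrightarrow> g (k x) = f x"
  shows "k ` carrier X = carrier Z"
proof (rule ccontr)
  assume neq: "k ` carrier X \<noteq> carrier Z"
  have rX: "rigid_phantom R X N f" using X by (simp add: maximal_rigid_phantom_def)
  have inj: "inj_on k (carrier X)"
    by (rule rigid_phantom_inj_on[OF rX rigid_phantom_imp_phantom[OF Z] k over])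
  obtain \<iota> :: "'t \<Rightarrow> ('r + 'n + nat) list set" where \<iota>: "inj_on \<iota> (carrier Z)"
    using rigid_phantom_embedding[OF Z] by blast
  obtain \<kappa> :: "('r + 'n + nat) list set \<times> ('r + 'n + nat) list set set \<Rightarrow> ('r + 'n + nat) list set"
    where \<kappa>: "inj_on \<kappa> (carrier X)"
    using rigid_phantom_embedding[OF rX] by blast
  have "\<forall>u. \<exists>A. (u, A) \<notin> carrier X" using fresh_second_component[OF \<kappa>] by blast
  then obtain A where A: "\<And>u. (u, A u) \<notin> carrier X" by metis
  define \<tau> where "\<tau> z = (if z \<in> k ` carrier X then inv_into (carrier X) k z else (\<iota> z, A (\<iota> z)))" for z
  have \<tau>k: "\<tau> (k x) = x" if "x \<in> carrier X" for x
    using that inj by (simp add: \<tau>_def)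
  have \<tau>_old: "\<tau> z \<in> carrier X" "k (\<tau> z) = z" if "z \<in> k ` carrier X" for z
    using that \<tau>k by auto
  have \<tau>_new: "z \<in> k ` carrier X" if "\<tau> z \<in> carrier X" for z
  proof (rule ccontr)
    assume "z \<notin> k ` carrier X"
    then have "\<tau> z = (\<iota> z, A (\<iota> z))" unfolding \<tau>_def by (rule if_not_P)
    then show False using that A[of "\<iota> z"] by simp
  qed
  have inj\<tau>: "inj_on \<tau> (carrier Z)"
  proof (rule inj_onI)
    fix y z assume yz: "y \<in> carrier Z" "z \<in> carrier Z" "\<tau> y = \<tau> z"
    show "y = z"
    proof (cases "y \<in> k ` carrier X \<or> z \<in> k ` carrier X")
      case True
      then have "\<tau> y \<in> carrier X"
      proof
        assume "z \<in> k ` carrier X"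
        then show ?thesis unfolding yz(3) by (rule \<tau>_old(1))
      qed (rule \<tau>_old(1))
      then have yk: "y \<in> k ` carrier X" and zk: "z \<in> k ` carrier X"
        using \<tau>_new[of y] \<tau>_new[of z] yz(3) by simp_all
      have "y = k (\<tau> y)" by (rule \<tau>_old(2)[OF yk, symmetric])
      also have "\<dots> = k (\<tau> z)" unfolding yz(3) ..
      also have "\<dots> = z" by (rule \<tau>_old(2)[OF zk])
      finally show ?thesis .
    next
      case False
      then have "\<iota> y = \<iota> z" using yz(3) by (simp add: \<tau>_def)
      then show ?thesis using \<iota> yz by (simp add: inj_on_def)
    qed
  qed
  show False
  proof (rule rigid_phantom_copy[OF Z inj\<tau>])
    fix Z' :: "('r, ('r + 'n + nat) list set \<times> ('r + 'n + nat) list set set) module" and \<sigma>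
    assume Z': "rigid_phantom R Z' N (\<lambda>y. g (\<sigma> y))" "carrier Z' = \<tau> ` carrier Z"
      "\<tau> \<in> mod_hom R Z Z'" "\<sigma> \<in> mod_hom R Z' Z"
      "\<And>x. x \<in> carrier Z \<Longrightarrow> \<sigma> (\<tau> x) = x" "\<And>y. y \<in> carrier Z' \<Longrightarrow> \<tau> (\<sigma> y) = y"
    interpret X: left_module R X by (rule phantomD(1)[OF rigid_phantom_imp_phantom[OF rX]])
    note h = mod_homD[OF mod_hom_comp[OF k Z'(3)]]
    have "phantom_extension R (X, f) (Z', \<lambda>y. g (\<sigma> y))"
    proof (rule phantom_extensionI)
      show "x \<in> carrier (fst (Z', \<lambda>y. g (\<sigma> y)))" if "x \<in> carrier (fst (X, f))" for x
        using h(1)[of x] \<tau>k that by simp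
      show "x \<oplus>\<^bsub>fst (Z', \<lambda>y. g (\<sigma> y))\<^esub> y = x \<oplus>\<^bsub>fst (X, f)\<^esub> y"
        if "x \<in> carrier (fst (X, f))" "y \<in> carrier (fst (X, f))" for x y
        using h(2)[of x y] \<tau>k that by simp
      show "a \<odot>\<^bsub>fst (Z', \<lambda>y. g (\<sigma> y))\<^esub> x = a \<odot>\<^bsub>fst (X, f)\<^esub> x"
        if "a \<in> carrier R" "x \<in> carrier (fst (X, f))" for a x
        using h(3)[of a x] \<tau>k that by simp
      show "snd (Z', \<lambda>y. g (\<sigma> y)) x = snd (X, f) x" if x: "x \<in> carrier (fst (X, f))" for x
      proof -
        have "\<sigma> (\<tau> (k x)) = k x" using Z'(5)[OF mod_homD(1)[OF k]] x by simp
        then show ?thesis using \<tau>k over x by simp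
      qed
    qed
    then have "carrier Z' \<subseteq> carrier X" using X Z'(1) unfolding maximal_rigid_phantom_def by blast
    moreover obtain z where "z \<in> carrier Z" "z \<notin> k ` carrier X"
      using neq mod_homD(1)[OF k] by blast
    ultimately show False using \<tau>_new[of z] Z'(2) by auto
  qed
qed

section \<open>Maximal rigid phantoms are covers\<close>

text \<open>
  Map to \<open>R\<^sup>l \<oplus> R\<^bsup>l'\<^esup> = R\<^bsup>l + l'\<^esup>\<close> by both first factors at once.
\<close>
lemma factors_through_free_add:
  fixes N :: "('r, 'n, 'y) module_scheme"
  assumes N: "left_module R N" and "factors_through_free R n S N w1" "factors_through_free R n S N w2"
  shows "factors_through_free R n S N (\<lambda>x. w1 x \<oplus>\<^bsub>N\<^esub> w2 x)"
proof -
  interpret N: left_module R N by fact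
  let ?F = "free_mod R n"
  obtain l u v where 1: "u \<in> mod_hom R ?F (free_mod R l)" "v \<in> mod_hom R (free_mod R l) N"
      "\<forall>s\<in>S. u s = \<zero>\<^bsub>free_mod R l\<^esub>" "\<forall>x\<in>carrier ?F. w1 x = v (u x)"
    using assms(2) unfolding factors_through_free_def by blast
  obtain l' u' v' where 2: "u' \<in> mod_hom R ?F (free_mod R l')" "v' \<in> mod_hom R (free_mod R l') N"
      "\<forall>s\<in>S. u' s = \<zero>\<^bsub>free_mod R l'\<^esub>" "\<forall>x\<in>carrier ?F. w2 x = v' (u' x)"
    using assms(3) unfolding factors_through_free_def by blast
  define a where "a x = (\<lambda>i\<in>{..<l + l'}. if i < l then u x i else u' x (i - l))" for x
  define \<pi> where "\<pi> z = (\<lambda>i\<in>{..<l}. z i)" for z :: "nat \<Rightarrow> 'r"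
  define \<pi>' where "\<pi>' z = (\<lambda>i\<in>{..<l'}. z (l + i))" for z :: "nat \<Rightarrow> 'r"
  have ux: "u x i \<in> carrier R" if "x \<in> carrier ?F" "i < l" for x i
    using mod_homD(1)[OF 1(1) that(1)] that(2) by (auto simp: free_mod_def)
  have u'x: "u' x i \<in> carrier R" if "x \<in> carrier ?F" "i < l'" for x i
    using mod_homD(1)[OF 2(1) that(1)] that(2) by (auto simp: free_mod_def)
  have a: "a \<in> mod_hom R ?F (free_mod R (l + l'))"
  proof (rule mod_homI)
    show "a x \<in> carrier (free_mod R (l + l'))" if "x \<in> carrier ?F" for x
      using ux[OF that] u'x[OF that] by (auto simp: a_def free_mod_def)
    show "a (x \<oplus>\<^bsub>?F\<^esub> y) = a x \<oplus>\<^bsub>free_mod R (l + l')\<^esub> a y" if "x \<in> carrier ?F" "y \<in> carrier ?F" for x y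
      unfolding a_def mod_homD(2)[OF 1(1) that] mod_homD(2)[OF 2(1) that]
      by (auto simp: free_mod_def fun_eq_iff)
    show "a (c \<odot>\<^bsub>?F\<^esub> x) = c \<odot>\<^bsub>free_mod R (l + l')\<^esub> a x" if "c \<in> carrier R" "x \<in> carrier ?F" for c x
      unfolding a_def mod_homD(3)[OF 1(1) that] mod_homD(3)[OF 2(1) that]
      by (auto simp: free_mod_def fun_eq_iff)
  qed
  have \<pi>: "\<pi> \<in> mod_hom R (free_mod R (l + l')) (free_mod R l)"
    by (rule mod_homI) (auto simp: \<pi>_def free_mod_def fun_eq_iff PiE_iff restrict_def extensional_def)
  have \<pi>': "\<pi>' \<in> mod_hom R (free_mod R (l + l')) (free_mod R l')"
    by (rule mod_homI) (auto simp: \<pi>'_def free_mod_def fun_eq_iff PiE_iff restrict_def extensional_def)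
  have \<pi>a: "\<pi> (a x) = u x" if "x \<in> carrier ?F" for x
    using mod_homD(1)[OF 1(1) that] by (auto simp: \<pi>_def a_def free_mod_def fun_eq_iff PiE_iff extensional_def)
  have \<pi>'a: "\<pi>' (a x) = u' x" if "x \<in> carrier ?F" for x
    using mod_homD(1)[OF 2(1) that] by (auto simp: \<pi>'_def a_def free_mod_def fun_eq_iff PiE_iff extensional_def)
  show ?thesis
  proof (rule factors_through_freeI[OF a mod_hom_add[OF N mod_hom_comp[OF \<pi> 1(2)] mod_hom_comp[OF \<pi>' 2(2)]]])
    show "a s = \<zero>\<^bsub>free_mod R (l + l')\<^esub>" if "s \<in> S" for s
      using 1(3) 2(3) that by (auto simp: a_def free_mod_def fun_eq_iff)
    show "w1 x \<oplus>\<^bsub>N\<^esub> w2 x = v (\<pi> (a x)) \<oplus>\<^bsub>N\<^esub> v' (\<pi>' (a x))" if "x \<in> carrier ?F" for x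
      using 1(4) 2(4) that by (simp add: \<pi>a \<pi>'a)
  qed
qed

lemma phantom_direct_sum:
  fixes X :: "('r, 'a, 'x) module_scheme" and Y :: "('r, 'b, 'w) module_scheme"
  assumes "phantom R X N f" "phantom R Y N g"
  obtains D :: "('r, 'a \<times> 'b) module" and d i j
  where "phantom R D N d" "i \<in> mod_hom R X D" "j \<in> mod_hom R Y D"
    "\<And>x. x \<in> carrier X \<Longrightarrow> d (i x) = f x" "\<And>y. y \<in> carrier Y \<Longrightarrow> d (j y) = g y"
proof -
  note X = phantomD(1)[OF assms(1)] and Y = phantomD(1)[OF assms(2)] and N = phantomD(2)[OF assms(1)]
  note f = phantomD(3)[OF assms(1)] and g = phantomD(3)[OF assms(2)]
  interpret X: left_module R X by (rule X)
  interpret Y: left_module R Y by (rule Y)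
  interpret N: left_module R N by (rule N)
  define D :: "('r, 'a \<times> 'b) module" where "D =
    \<lparr>carrier = carrier X \<times> carrier Y, mult = undefined, one = undefined, zero = (\<zero>\<^bsub>X\<^esub>, \<zero>\<^bsub>Y\<^esub>),
     add = (\<lambda>p q. (fst p \<oplus>\<^bsub>X\<^esub> fst q, snd p \<oplus>\<^bsub>Y\<^esub> snd q)),
     smult = (\<lambda>a p. (a \<odot>\<^bsub>X\<^esub> fst p, a \<odot>\<^bsub>Y\<^esub> snd p))\<rparr>"
  have "abelian_group D"
  proof (rule abelian_groupI)
    fix p assume "p \<in> carrier D"
    then show "\<exists>q\<in>carrier D. q \<oplus>\<^bsub>D\<^esub> p = \<zero>\<^bsub>D\<^esub>"
      by (intro bexI[of _ "(\<ominus>\<^bsub>X\<^esub> fst p, \<ominus>\<^bsub>Y\<^esub> snd p)"]) (auto simp: D_def X.M.l_neg Y.M.l_neg)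
  qed (auto simp: D_def X.M.a_ac Y.M.a_ac)
  then have D: "left_module R D"
    by (intro left_module.intro left_module_axioms.intro X.R.ring_axioms)
      (auto simp: D_def X.smult_l_distr X.smult_r_distr X.smult_assoc1
        Y.smult_l_distr Y.smult_r_distr Y.smult_assoc1)
  have p1: "fst \<in> mod_hom R D X" by (rule mod_homI) (auto simp: D_def)
  have p2: "snd \<in> mod_hom R D Y" by (rule mod_homI) (auto simp: D_def)
  have i: "(\<lambda>x. (x, \<zero>\<^bsub>Y\<^esub>)) \<in> mod_hom R X D" by (rule mod_homI) (auto simp: D_def Y.smult_zero_right)
  have j: "(\<lambda>y. (\<zero>\<^bsub>X\<^esub>, y)) \<in> mod_hom R Y D" by (rule mod_homI) (auto simp: D_def X.smult_zero_right)
  let ?d = "\<lambda>p. f (fst p) \<oplus>\<^bsub>N\<^esub> g (snd p)"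
  have "phantom R D N ?d"
  proof (rule phantomI[OF D N mod_hom_add[OF N mod_hom_comp[OF p1 f] mod_hom_comp[OF p2 g]]])
    fix n S h
    assume S: "finite S" "S \<subseteq> carrier (free_mod R n)" and h: "h \<in> mod_hom R (free_mod R n) D"
      and hS: "\<And>s. s \<in> S \<Longrightarrow> h s = \<zero>\<^bsub>D\<^esub>"
    show "factors_through_free R n S N (\<lambda>x. f (fst (h x)) \<oplus>\<^bsub>N\<^esub> g (snd (h x)))"
    proof (rule factors_through_free_add[OF N])
      show "factors_through_free R n S N (\<lambda>x. f (fst (h x)))"
        by (rule phantom_relations[OF assms(1) S mod_hom_comp[OF h p1]]) (simp add: hS D_def)
      show "factors_through_free R n S N (\<lambda>x. g (snd (h x)))"
        by (rule phantom_relations[OF assms(2) S mod_hom_comp[OF h p2]]) (simp add: hS D_def)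
    qed
  qed
  then show thesis
  proof (rule that[OF _ i j])
    show "f (fst (x, \<zero>\<^bsub>Y\<^esub>)) \<oplus>\<^bsub>N\<^esub> g (snd (x, \<zero>\<^bsub>Y\<^esub>)) = f x" if "x \<in> carrier X" for x
      using mod_homD(1)[OF f that] mod_hom_zero[OF Y N g] by simp
    show "f (fst (\<zero>\<^bsub>X\<^esub>, y)) \<oplus>\<^bsub>N\<^esub> g (snd (\<zero>\<^bsub>X\<^esub>, y)) = g y" if "y \<in> carrier Y" for y
      using mod_homD(1)[OF g that] mod_hom_zero[OF X N f] by simp
  qed
qed

text \<open>
  Here \<open>Q\<close> is a rigid quotient of \<open>X \<oplus> Y\<close>.  The map \<open>X \<rightarrow> Q\<close> is injective as \<open>X\<close> is rigid and surjective as
  \<open>X\<close> is maximal; \<open>r\<close> is its inverse.  The type \<open>'t\<close> of \<open>Y\<close> is arbitrary, since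
  the size of \<open>Q\<close> is controlled by its rigidity and not by its type.
\<close>
lemma maximal_rigid_phantom_precover:
  fixes X :: "('r, ('r + 'n + nat) list set \<times> ('r + 'n + nat) list set set) module"
    and Y :: "('r, 't, 'x) module_scheme" and N :: "('r, 'n, 'y) module_scheme"
  assumes X: "maximal_rigid_phantom R X N f" and Y: "phantom R Y N g"
  shows "\<exists>k \<in> mod_hom R Y X. \<forall>y\<in>carrier Y. f (k y) = g y"
proof -
  have rX: "rigid_phantom R X N f" using X by (simp add: maximal_rigid_phantom_def)
  note pX = rigid_phantom_imp_phantom[OF rX]
  show ?thesis
  proof (rule phantom_direct_sum[OF pX Y])
    fix D :: "('r, (('r + 'n + nat) list set \<times> ('r + 'n + nat) list set set) \<times> 't) module" and d i j
    assume D: "phantom R D N d" "i \<in> mod_hom R X D" "j \<in> mod_hom R Y D"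
      "\<And>x. x \<in> carrier X \<Longrightarrow> d (i x) = f x" "\<And>y. y \<in> carrier Y \<Longrightarrow> d (j y) = g y"
    show ?thesis
    proof (rule rigid_quotient[OF D(1)])
      fix Q :: "('r, ((('r + 'n + nat) list set \<times> ('r + 'n + nat) list set set) \<times> 't) set) module" and e q
      assume Q: "rigid_phantom R Q N e" "q \<in> mod_hom R D Q" "\<And>x. x \<in> carrier D \<Longrightarrow> e (q x) = d x"
      let ?k = "\<lambda>x. q (i x)"
      have k: "?k \<in> mod_hom R X Q" by (rule mod_hom_comp[OF D(2) Q(2)])
      have over: "e (?k x) = f x" if "x \<in> carrier X" for x
        using Q(3)[OF mod_homD(1)[OF D(2) that]] D(4)[OF that] by simp
      have surj: "?k ` carrier X = carrier Q"
        by (rule maximal_rigid_phantom_absorbs[OF X Q(1) k over])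
      have inj: "inj_on ?k (carrier X)"
        by (rule rigid_phantom_inj_on[OF rX rigid_phantom_imp_phantom[OF Q(1)] k over])
      note lX = phantomD(1)[OF pX] and lQ = phantomD(1)[OF rigid_phantom_imp_phantom[OF Q(1)]]
      have id: "(\<lambda>x. x) \<in> mod_hom R X X" by (rule mod_homI) auto
      have "x = \<zero>\<^bsub>X\<^esub>" if x: "x \<in> carrier X" "?k x = \<zero>\<^bsub>Q\<^esub>" for x
      proof -
        interpret X: left_module R X by (rule lX)
        have "?k x = ?k \<zero>\<^bsub>X\<^esub>" using x(2) mod_hom_zero[OF lX lQ k] by simp
        then show ?thesis using inj x(1) X.M.zero_closed by (simp add: inj_on_def)
      qed
      then obtain r where r: "r \<in> mod_hom R Q X" "\<And>x. x \<in> carrier X \<Longrightarrow> r (?k x) = x"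
        using mod_hom_factor_surj[OF lX lQ lX k surj id] by metis
      have e: "f (r z) = e z" if "z \<in> carrier Q" for z
      proof -
        have "z \<in> ?k ` carrier X" using that surj by simp
        then obtain x where "x \<in> carrier X" "z = ?k x" by blast
        then show ?thesis using over r(2) by simp
      qed
      have "f (r (q (j y))) = g y" if "y \<in> carrier Y" for y
        using e[OF mod_homD(1)[OF mod_hom_comp[OF D(3) Q(2)] that]]
          Q(3)[OF mod_homD(1)[OF D(3) that]] D(5)[OF that] by simp
      then show ?thesis
        by (intro bexI[OF _ mod_hom_comp[OF mod_hom_comp[OF D(3) Q(2)] r(1)]] ballI)
    qed
  qed
qed

theorem corollary4p10:
  fixes R :: "('r, 'z) ring_scheme" and N :: "('r, 'n, 'y) module_scheme"
  assumes "ring R" and "left_module R N"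
  shows "(\<exists>(M :: ('r, ('r, 'n) cover_carrier) module) \<phi>.
            phantom_cover TYPE(('r, 'n) cover_carrier) R M N \<phi> \<and> \<phi> ` carrier M = carrier N) \<and>
         (\<forall>(M :: ('r, ('r, 'n) cover_carrier) module) \<phi>.
            phantom_cover TYPE(('r, 'n) cover_carrier) R M N \<phi> \<longrightarrow> phantom_cover TYPE('t) R M N \<phi>)"
proof -
  interpret N: left_module R N by fact
  obtain X :: "('r, ('r + 'n + nat) list set \<times> ('r + 'n + nat) list set set) module" and f
    where X: "maximal_rigid_phantom R X N f"
    by (rule maximal_rigid_phantom_exists[OF assms(2)]) (rule that)
  then have rX: "rigid_phantom R X N f" by (simp add: maximal_rigid_phantom_def)
  note pX = rigid_phantom_imp_phantom[OF rX]
  obtain \<kappa> :: "('r + 'n + nat) list set \<times> ('r + 'n + nat) list set set \<Rightarrow> ('r + 'n + nat) list set"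
    where \<kappa>: "inj_on \<kappa> (carrier X)"
    using rigid_phantom_embedding[OF rX] by blast
  \<comment> \<open>Forming singletons only adjusts the type: \<open>X\<close> already fits into \<open>('r + 'n + nat) list set\<close>.\<close>
  have "inj_on (\<lambda>x. {\<kappa> x}) (carrier X)" using \<kappa> by (auto simp: inj_on_def)
  note inj = this
  obtain M :: "('r, ('r, 'n) cover_carrier) module" and \<tau> \<sigma>
    where M: "rigid_phantom R M N (\<lambda>y. f (\<sigma> y))" "\<tau> \<in> mod_hom R X M" "\<sigma> \<in> mod_hom R M X"
      "\<And>x. x \<in> carrier X \<Longrightarrow> \<sigma> (\<tau> x) = x" "\<And>y. y \<in> carrier M \<Longrightarrow> \<tau> (\<sigma> y) = y"
    by (rule rigid_phantom_copy[OF rX inj]) (rule that)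
  let ?\<phi> = "\<lambda>y. f (\<sigma> y)"
  note pM = rigid_phantom_imp_phantom[OF M(1)]
  have over: "?\<phi> (\<tau> x) = f x" if "x \<in> carrier X" for x using M(4)[OF that] by simp
  have auto: "mod_automorphism R M j"
    if j: "j \<in> mod_hom R M M" and j\<phi>: "\<forall>x\<in>carrier M. ?\<phi> (j x) = ?\<phi> x" for j
  proof -
    have "inj_on j (carrier M)"
      by (rule rigid_phantom_inj_on[OF M(1) pM j]) (use j\<phi> in blast)
    moreover have "(\<lambda>x. j (\<tau> x)) ` carrier X = carrier M"
    proof (rule maximal_rigid_phantom_absorbs[OF X M(1) mod_hom_comp[OF M(2) j]])
      show "?\<phi> (j (\<tau> x)) = f x" if "x \<in> carrier X" for x
        using j\<phi> mod_homD(1)[OF M(2) that] over[OF that] by simp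
    qed
    then have "carrier M \<subseteq> j ` carrier M" using mod_homD(1)[OF M(2)] by blast
    then have "j ` carrier M = carrier M" using mod_homD(1)[OF j] by blast
    ultimately show ?thesis using j by (simp add: mod_automorphism_def bij_betw_def)
  qed
  have pre: "\<exists>k \<in> mod_hom R Y M. \<forall>x\<in>carrier Y. ?\<phi> (k x) = g x"
    if Y: "phantom R Y N g" for Y :: "('r, ('r, 'n) cover_carrier) module" and g
  proof -
    obtain k where k: "k \<in> mod_hom R Y X" "\<forall>y\<in>carrier Y. f (k y) = g y"
      using maximal_rigid_phantom_precover[OF X Y] by blast
    show ?thesis
      by (rule bexI[OF _ mod_hom_comp[OF k(1) M(2)]]) (use k(2) over mod_homD(1)[OF k(1)] in simp)
  qed
  have cover: "phantom_cover TYPE(('r, 'n) cover_carrier) R M N ?\<phi>"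
    unfolding phantom_cover_def using pM pre auto by blast
  have "\<exists>x\<in>carrier M. ?\<phi> x = y" if y: "y \<in> carrier N" for y
  proof -
    \<comment> \<open>The map \<open>R \<rightarrow> N\<close>, \<open>1 \<mapsto> y\<close>, is phantom and factors through \<open>X\<close>.\<close>
    let ?F = "free_mod R 1" and ?e = "unit_vector R 1 0"
    have h: "(\<lambda>x. x 0 \<odot>\<^bsub>N\<^esub> y) \<in> mod_hom R ?F N"
      using y by (intro mod_homI) (auto simp: free_mod_def PiE_iff N.smult_l_distr N.smult_assoc1)
    obtain k where k: "k \<in> mod_hom R ?F X" "\<forall>x\<in>carrier ?F. f (k x) = x 0 \<odot>\<^bsub>N\<^esub> y"
      using maximal_rigid_phantom_precover[OF X phantom_free_mod[OF assms(2) h]] by blast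
    have e: "?e \<in> carrier ?F" by (rule unit_vector_closed[OF assms(1)])
    have ke: "k ?e \<in> carrier X" by (rule mod_homD(1)[OF k(1) e])
    have "?e 0 = \<one>\<^bsub>R\<^esub>" by (simp add: unit_vector_def)
    then have "?\<phi> (\<tau> (k ?e)) = y" using over[OF ke] k(2) e y by simp
    then show ?thesis using mod_homD(1)[OF M(2) ke] by blast
  qed
  then have surj: "?\<phi> ` carrier M = carrier N" using mod_homD(1)[OF phantomD(3)[OF pM]] by blast
  have "phantom_cover TYPE('t) R M' N \<psi>"
    if M': "phantom_cover TYPE(('r, 'n) cover_carrier) R M' N \<psi>"
    for M' :: "('r, ('r, 'n) cover_carrier) module" and \<psi>
  proof -
    \<comment> \<open>The given cover receives a map from \<open>M\<close>, hence from every phantom to \<open>N\<close>, whatever its type.\<close>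
    obtain m where m: "m \<in> mod_hom R M M'" "\<forall>x\<in>carrier M. \<psi> (m x) = ?\<phi> x"
      using M' pM unfolding phantom_cover_def by blast
    have "\<exists>k \<in> mod_hom R Y M'. \<forall>x\<in>carrier Y. \<psi> (k x) = g x"
      if Y: "phantom R Y N g" for Y :: "('r, 't) module" and g
    proof -
      obtain k where k: "k \<in> mod_hom R Y X" "\<forall>y\<in>carrier Y. f (k y) = g y"
        using maximal_rigid_phantom_precover[OF X Y] by blast
      show ?thesis
      proof (rule bexI[OF _ mod_hom_comp[OF mod_hom_comp[OF k(1) M(2)] m(1)]], rule ballI)
        fix x assume x: "x \<in> carrier Y"
        have kx: "k x \<in> carrier X" by (rule mod_homD(1)[OF k(1) x])
        show "\<psi> (m (\<tau> (k x))) = g x"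
          using m(2) mod_homD(1)[OF M(2) kx] over[OF kx] k(2) x by simp
      qed
    qed
    then show ?thesis using M' unfolding phantom_cover_def by blast
  qed
  then show ?thesis using cover surj by blast
qed

end
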